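(* Let $M\ge1$ be an integer and let $\beta_{\mathrm d},\beta_{\mathrm{br}},\beta_{\mathrm{ru}},\bar\tau>0$ and $A=\lVert\mathbf R_{\mathrm d}^{1/2}\mathbf a_{\mathrm b}\rVert_2$ be fixed. For each integer $N\ge1$, with $\mathbb E\{\mathrm{SNR}\}_{\mathrm{UB}}$ and $\mathbb E\{\mathrm{SNR}\}_{\mathrm{LB}}$ the mean optimal SNRs for a fully correlated and an uncorrelated UE-RIS channel (given in the context), define the relative gain due to correlation in the UE-RIS channel by $$\mathrm{Gain}_{\mathrm{corr}}=\frac{\mathbb E\{\mathrm{SNR}\}_{\mathrm{UB}}-\mathbb E\{\mathrm{SNR}\}_{\mathrm{LB}}}{\mathbb E\{\mathrm{SNR}\}_{\mathrm{LB}}}.$$ Then $$\mathrm{Gain}_{\mathrm{corr}}=\frac{(4-\pi)N^2+(\pi-4)N}{\pi N^2+(4-\pi)N+\dfrac{4\beta_{\mathrm d}}{\beta_{\mathrm{br}}\beta_{\mathrm{ru}}}+\dfrac{2NA\pi\sqrt{\beta_{\mathrm d}}}{M\sqrt{\beta_{\mathrm{br}}\beta_{\mathrm{ru}}}}},$$ and $$\lim_{N\to\infty}\mathrm{Gain}_{\mathrm{corr}}=\frac{4-\pi}{\pi}\approx 27.32\%.$$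
   Context: The setting is a single-user uplink with $M$ base station antennas and a reconfigurable intelligent surface (RIS) with $N$ elements. $\mathbf R_{\mathrm d}\in\mathbb C^{M\times M}$ is the UE-BS correlation matrix (Hermitian positive semidefinite, unit diagonal), $\mathbf a_{\mathrm b}\in\mathbb C^M$ is the BS steering vector (entries of modulus 1) of the rank-1 RIS-BS channel, with $\mathbf R_{\mathrm d}^{1/2}\mathbf a_{\mathrm b}\ne\mathbf 0$; $\beta_{\mathrm d},\beta_{\mathrm{br}},\beta_{\mathrm{ru}}$ are link gains. The channel is $\mathbf h=\mathbf h_{\mathrm d}+\sqrt{\beta_{\mathrm{br}}\beta_{\mathrm{ru}}}\,\psi\,\big(\sum_{n=1}^N|\tilde h_{\mathrm{ru},n}|\big)\mathbf a_{\mathrm b}$ with optimal RIS phases, where $\mathbf h_{\mathrm d}\sim\mathcal{CN}(\mathbf 0,\beta_{\mathrm d}\mathbf R_{\mathrm d})$ is independent of $\tilde{\mathbf h}_{\mathrm{ru}}\sim\mathcal{CN}(\mathbf 0,\mathbf R_{\mathrm{ru}})$, $\psi=\mathbf a_{\mathrm b}^H\mathbf h_{\mathrm d}/|\mathbf a_{\mathrm b}^H\mathbf h_{\mathrm d}|$, and $\mathrm{SNR}=\mathbf h^H\mathbf h\,\bar\tau$. $\mathbb E\{\mathrm{SNR}\}_{\mathrm{LB}}$ and $\mathbb E\{\mathrm{SNR}\}_{\mathrm{UB}}$ are the values of $\mathbb E\{\mathrm{SNR}\}$ when $\mathbf R_{\mathrm{ru}}=\mathbf I_N$ and when $\mathbf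 R_{\mathrm{ru}}$ is the all-ones $N\times N$ matrix, respectively; they are given explicitly by $$\mathbb E\{\mathrm{SNR}\}_{\mathrm{LB}}=\left(\beta_{\mathrm d}M+\frac{NA\pi}{2}\sqrt{\beta_{\mathrm d}\beta_{\mathrm{br}}\beta_{\mathrm{ru}}}+\beta_{\mathrm{br}}\beta_{\mathrm{ru}}M\Big(N+N(N-1)\frac{\pi}{4}\Big)\right)\bar\tau,$$ $$\mathbb E\{\mathrm{SNR}\}_{\mathrm{UB}}=\left(\beta_{\mathrm d}M+\frac{NA\pi}{2}\sqrt{\beta_{\mathrm d}\beta_{\mathrm{br}}\beta_{\mathrm{ru}}}+\beta_{\mathrm{br}}\beta_{\mathrm{ru}}MN^2\right)\bar\tau.$$ *)

theory Defs
  imports "HOL-Probability.Probability"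
begin

text \<open>Inner product \<open>x\<^sup>H y\<close>, conjugate linear in the first argument.\<close>

definition hprod :: "complex ^ 'm \<Rightarrow> complex ^ 'm \<Rightarrow> complex" where
  "hprod x y = (\<Sum>i\<in>UNIV. cnj (x $ i) * y $ i)"

definition hermitian :: "complex ^ 'm ^ 'm \<Rightarrow> bool" where
  "hermitian R \<longleftrightarrow> (\<forall>i j. R $ i $ j = cnj (R $ j $ i))"

definition hermitian_psd :: "complex ^ 'm ^ 'm \<Rightarrow> bool" where
  "hermitian_psd R \<longleftrightarrow> hermitian R \<and> (\<forall>x. 0 \<le> Re (hprod x (R *v x)))"

text \<open>\<open>S = R\<^sup>1\<^sup>/\<^sup>2\<close>; such an \<open>S\<close> exists and is unique for every Hermitian positive
  semidefinite \<open>R\<close>.\<close>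

definition is_psd_sqrt :: "complex ^ 'm ^ 'm \<Rightarrow> complex ^ 'm ^ 'm \<Rightarrow> bool" where
  "is_psd_sqrt S R \<longleftrightarrow> hermitian_psd S \<and> S ** S = R"

text \<open>The scalar law CN(0,1).\<close>

definition std_complex_normal :: "complex measure" where
  "std_complex_normal = density lborel (\<lambda>z. ennreal (exp (- (cmod z)\<^sup>2) / pi))"

text \<open>The family \<open>(X i)\<close>, \<open>i \<in> I\<close>, is a CN(0,R) vector: every \<open>c\<^sup>H X\<close> is a scalar
  CN(0, \<open>c\<^sup>H R c\<close>) variable, i.e. distributed as \<open>\<surd>(c\<^sup>H R c) W\<close> with \<open>W\<close> a CN(0,1) variable.
  Scaling \<open>W\<close>, rather than using a density, allows singular \<open>R\<close> (a zero variance
  gives the point mass at 0).\<close>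

definition complex_normal_vector ::
    "'w measure \<Rightarrow> 'i set \<Rightarrow> ('i \<Rightarrow> 'w \<Rightarrow> complex) \<Rightarrow> ('i \<Rightarrow> 'i \<Rightarrow> complex) \<Rightarrow> bool" where
  "complex_normal_vector P I X R \<longleftrightarrow>
     (\<forall>i\<in>I. X i \<in> borel_measurable P) \<and>
     (\<forall>c. distr P borel (\<lambda>\<omega>. \<Sum>i\<in>I. cnj (c i) * X i \<omega>) =
          distr std_complex_normal borel
            (\<lambda>w. complex_of_real (sqrt (Re (\<Sum>i\<in>I. \<Sum>j\<in>I. cnj (c i) * R i j * c j))) * w))"

text \<open>Random part of the model: the UE-BS channel \<open>h_d\<close> is CN(0, \<open>\<beta>\<^sub>d R\<^sub>d\<close>), the normalised UE-RIS
  channel \<open>h_ru\<close> (entries indexed by \<open>1, \<dots>, N\<close>) is CN(0, \<open>R\<^sub>r\<^sub>u\<close>), and the two are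
  independent, i.e. the sigma-algebras they generate are (the library's \<open>indep_var\<close> needs both variables
  to have the same type).\<close>

definition fading_model ::
    "real \<Rightarrow> complex ^ 'm ^ 'm \<Rightarrow> nat \<Rightarrow> (nat \<Rightarrow> nat \<Rightarrow> complex) \<Rightarrow>
     'w measure \<Rightarrow> ('w \<Rightarrow> complex ^ 'm) \<Rightarrow> ('w \<Rightarrow> nat \<Rightarrow> complex) \<Rightarrow> bool" where
  "fading_model \<beta>d Rd N Rru P h_d h_ru \<longleftrightarrow>
     prob_space P \<and>
     complex_normal_vector P UNIV (\<lambda>i \<omega>. h_d \<omega> $ i) (\<lambda>i j. complex_of_real \<beta>d * Rd $ i $ j) \<and>
     complex_normal_vector P {1..N} (\<lambda>n \<omega>. h_ru \<omega> n) Rru \<and>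
     prob_space.indep_set P
       (sets (vimage_algebra (space P) h_d borel))
       (sets (vimage_algebra (space P) (\<lambda>\<omega>. restrict (h_ru \<omega>) {1..N}) (PiM {1..N} (\<lambda>_. borel))))"

definition uncorrelated :: "nat \<Rightarrow> nat \<Rightarrow> complex" where
  "uncorrelated i j = (if i = j then 1 else 0)"

definition fully_correlated :: "nat \<Rightarrow> nat \<Rightarrow> complex" where
  "fully_correlated i j = 1"

text \<open>If \<open>ab\<^sup>H h = 0\<close> the value is 0; this is a null event for \<open>h = h_d\<close> when
  \<open>R\<^sub>d\<^sup>1\<^sup>/\<^sup>2 ab \<noteq> 0\<close>.\<close>

definition direct_phase :: "complex ^ 'm \<Rightarrow> complex ^ 'm \<Rightarrow> complex" where
  "direct_phase ab h = hprod ab h / complex_of_real (cmod (hprod ab h))"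

text \<open>Overall channel under the optimal RIS phases.\<close>

definition opt_channel ::
    "real \<Rightarrow> real \<Rightarrow> complex ^ 'm \<Rightarrow> nat \<Rightarrow> complex ^ 'm \<Rightarrow> (nat \<Rightarrow> complex) \<Rightarrow> complex ^ 'm" where
  "opt_channel \<beta>br \<beta>ru ab N h g =
     h + (complex_of_real (sqrt (\<beta>br * \<beta>ru)) * direct_phase ab h *
          complex_of_real (\<Sum>n\<in>{1..N}. cmod (g n))) *s ab"

definition opt_snr ::
    "real \<Rightarrow> real \<Rightarrow> real \<Rightarrow> complex ^ 'm \<Rightarrow> nat \<Rightarrow> complex ^ 'm \<Rightarrow> (nat \<Rightarrow> complex) \<Rightarrow> real" where
  "opt_snr \<beta>br \<beta>ru \<tau> ab N h g =
     Re (hprod (opt_channel \<beta>br \<beta>ru ab N h g) (opt_channel \<beta>br \<beta>ru ab N h g)) * \<tau>"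

definition mean_snr ::
    "real \<Rightarrow> real \<Rightarrow> real \<Rightarrow> complex ^ 'm \<Rightarrow> nat \<Rightarrow>
     'w measure \<Rightarrow> ('w \<Rightarrow> complex ^ 'm) \<Rightarrow> ('w \<Rightarrow> nat \<Rightarrow> complex) \<Rightarrow> real" where
  "mean_snr \<beta>br \<beta>ru \<tau> ab N P h_d h_ru =
     prob_space.expectation P (\<lambda>\<omega>. opt_snr \<beta>br \<beta>ru \<tau> ab N (h_d \<omega>) (h_ru \<omega>))"

definition gain_corr :: "real \<Rightarrow> real \<Rightarrow> real" where
  "gain_corr E_UB E_LB = (E_UB - E_LB) / E_LB"

end

theory Submission imports Defs begin

text \<open>Expanding the SNR gives \<open>\<parallel>h_d\<parallel>\<^sup>2 + 2\<surd>b |a\<^sup>H h_d| S + b M S\<^sup>2\<close> almost surely, where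
  \<open>b = \<beta>\<^sub>b\<^sub>r \<beta>\<^sub>r\<^sub>u\<close>, \<open>g = h_ru\<close> and \<open>S = \<Sum>\<^sub>n |g\<^sub>n|\<close>, so only the moments \<open>E|W|\<close>, \<open>E|W|\<^sup>2\<close> of a CN(0,1)
  variable \<open>W\<close> and the cross moments \<open>E|g\<^sub>m||g\<^sub>n|\<close> are needed. For uncorrelated \<open>g\<^sub>m\<close>, \<open>g\<^sub>n\<close> the last one is
  obtained without deriving their joint law. As \<open>r\<surd>\<pi> = \<integral>\<^sub>0\<^sup>\<infinity> (1 - exp(-u\<^sup>2r\<^sup>2))/u\<^sup>2 du\<close>, Tonelli's theorem
  reduces it to the joint Laplace transform of \<open>|g\<^sub>m|\<^sup>2\<close>, \<open>|g\<^sub>n|\<^sup>2\<close>; and since \<open>exp(-u\<^sup>2|z|\<^sup>2)\<close> is the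
  characteristic function of an auxiliary Gaussian at \<open>2uz\<close>, Fubini's theorem expresses that transform by the
  characteristic functions of the linear combinations of \<open>g\<^sub>m\<close> and \<open>g\<^sub>n\<close>, which the model prescribes.\<close>

subsection \<open>Complex Gaussian law\<close>

text \<open>The real normal law of variance 1/2: the law of the real and of the imaginary part of a
  CN(0,1) variable, which makes the second moment of its modulus equal to 1.\<close>

definition gauss_half :: "real measure" where
  "gauss_half = density lborel (\<lambda>x. ennreal (normal_density 0 (1 / sqrt 2) x))"

lemma normal_density_half: "normal_density 0 (1 / sqrt 2) x = exp (- x\<^sup>2) / sqrt pi"
  by (simp add: normal_density_def power_divide)

lemma sets_gauss_half [simp, measurable_cong]: "sets gauss_half = sets borel"
  and space_gauss_half [simp]: "space gauss_half = UNIV"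
  by (simp_all add: gauss_half_def)

interpretation gauss_half: prob_space gauss_half
  unfolding gauss_half_def by (rule prob_space_normal_density) simp

lemma sets_std_complex_normal [simp, measurable_cong]: "sets std_complex_normal = sets borel"
  and space_std_complex_normal [simp]: "space std_complex_normal = UNIV"
  by (simp_all add: std_complex_normal_def)

lemma measurable_Complex_pair [measurable]: "(\<lambda>(x, y). Complex x y) \<in> borel_measurable (borel \<Otimes>\<^sub>M borel)"
proof -
  have "(\<lambda>p. complex_of_real (fst p) + \<i> * complex_of_real (snd p)) \<in> borel_measurable (borel \<Otimes>\<^sub>M borel)"
    by measurable
  then show ?thesis
    by (simp add: complex_eq[symmetric] case_prod_unfold Complex_eq)
qed

text \<open>Lebesgue measure is determined by its values on boxes, and the preimage of a complex box
  under \<open>Complex\<close> is a rectangle of two open intervals.\<close>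

lemma lborel_complex_eq_distr:
  "(lborel :: complex measure) = distr (lborel \<Otimes>\<^sub>M lborel) borel (\<lambda>(x, y). Complex x y)"
proof (rule lborel_eqI)
  fix l u :: complex
  assume le: "\<And>b. b \<in> Basis \<Longrightarrow> l \<bullet> b \<le> u \<bullet> b"
  have [simp]: "Re l \<le> Re u" "Im l \<le> Im u"
    using le[of 1] le[of \<i>] by (auto simp: Basis_complex_def inner_complex_def)
  have "(\<lambda>(x, y). Complex x y) -` box l u \<inter> space (lborel \<Otimes>\<^sub>M lborel)
      = {Re l<..<Re u} \<times> {Im l<..<Im u}"
    by (auto simp: in_box_complex_iff space_pair_measure)
  then show "emeasure (distr (lborel \<Otimes>\<^sub>M lborel) borel (\<lambda>(x, y). Complex x y)) (box l u)
      = (\<Prod>b\<in>Basis. (u - l) \<bullet> b)"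
    by (subst emeasure_distr)
       (simp_all add: lborel.emeasure_pair_measure_Times Basis_complex_def inner_complex_def
         ennreal_mult)
qed simp

text \<open>The density \<open>exp (- (cmod z)\<^sup>2) / pi\<close> is the product of the densities
  exp(-x^2) / sqrt pi of the two coordinates. Hence every integral against CN(0,1) becomes one over
  a pair of independent real Gaussians.\<close>

lemma std_complex_normal_eq_distr:
  "std_complex_normal = distr (gauss_half \<Otimes>\<^sub>M gauss_half) borel (\<lambda>(x, y). Complex x y)"
proof -
  have "gauss_half \<Otimes>\<^sub>M gauss_half = density (lborel \<Otimes>\<^sub>M lborel)
      (\<lambda>(x, y). ennreal (normal_density 0 (1 / sqrt 2) x) * ennreal (normal_density 0 (1 / sqrt 2) y))"
    unfolding gauss_half_def
    by (intro pair_measure_density)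
       (auto intro: lborel.sigma_finite_measure_axioms gauss_half.sigma_finite_measure_axioms[unfolded gauss_half_def])
  also have "\<dots> = density (lborel \<Otimes>\<^sub>M lborel)
      (\<lambda>p. ennreal (exp (- (cmod ((\<lambda>(x, y). Complex x y) p))\<^sup>2) / pi))"
  proof (intro density_cong AE_I2)
    fix p :: "real \<times> real"
    show "(case p of (x, y) \<Rightarrow> ennreal (normal_density 0 (1 / sqrt 2) x) * ennreal (normal_density 0 (1 / sqrt 2) y))
      = ennreal (exp (- (cmod ((\<lambda>(x, y). Complex x y) p))\<^sup>2) / pi)"
      by (cases p) (simp add: normal_density_half ennreal_mult[symmetric] cmod_power2 exp_add[symmetric])
  qed simp_all
  finally show ?thesis
    unfolding std_complex_normal_def lborel_complex_eq_distr
    by (simp add: density_distr)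
qed

interpretation std_complex_normal: prob_space std_complex_normal
proof -
  interpret pair_prob_space gauss_half gauss_half ..
  show "prob_space std_complex_normal"
    unfolding std_complex_normal_eq_distr by (rule prob_space_distr) simp
qed

lemma char_gauss_half:
  "(CLINT x|gauss_half. iexp (t * x)) = complex_of_real (exp (- t\<^sup>2 / 4))"
proof -
  have "(CLINT x|gauss_half. iexp (t * x))
      = (CLINT x|lborel. normal_density 0 (1 / sqrt 2) x *\<^sub>R iexp (t * x))"
    unfolding gauss_half_def by (subst integral_density) auto
  \<comment> \<open>Rescaling by 1 / sqrt 2 turns the density into the standard one, whose
    characteristic function is known.\<close>
  also have "\<dots> = (1 / sqrt 2) *\<^sub>R (CLINT x|lborel. normal_density 0 (1 / sqrt 2) (1 / sqrt 2 * x) *\<^sub>R iexp (t * (1 / sqrt 2 * x)))"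
    by (subst lborel_integral_real_affine[where c = "1 / sqrt 2" and t = 0]) simp_all
  also have "\<dots> = (CLINT x|lborel. std_normal_density x *\<^sub>R iexp ((t / sqrt 2) * x))"
    by (subst integral_scaleR_right[symmetric])
       (intro Bochner_Integration.integral_cong, auto simp: normal_density_def power_divide real_sqrt_mult field_simps)
  also have "\<dots> = (CLINT x|std_normal_distribution. iexp ((t / sqrt 2) * x))"
    by (subst integral_density) auto
  also have "\<dots> = complex_of_real (exp (- ((t / sqrt 2)\<^sup>2) / 2))"
    using fun_cong[OF char_std_normal_distribution, of "t / sqrt 2"] by (simp add: char_def)
  finally show ?thesis by (simp add: power_divide)
qed

lemma (in pair_prob_space) integral_pair_mult:
  fixes f :: "'a \<Rightarrow> 'c::{real_normed_field, banach, second_countable_topology}"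
  assumes [measurable]: "f \<in> borel_measurable M1" "g \<in> borel_measurable M2"
    and "\<And>x. norm (f x) \<le> 1" "\<And>y. norm (g y) \<le> 1"
  shows "(\<integral>p. f (fst p) * g (snd p) \<partial>(M1 \<Otimes>\<^sub>M M2)) = (\<integral>x. f x \<partial>M1) * (\<integral>y. g y \<partial>M2)"
proof -
  have "integrable (M1 \<Otimes>\<^sub>M M2) (\<lambda>p. f (fst p) * g (snd p))"
    by (rule integrable_const_bound[where B = 1])
       (auto intro!: mult_le_one simp: norm_mult assms)
  from integral_fst'[OF this] show ?thesis by simp
qed

text \<open>\<open>Re (cnj z * w)\<close> is the real inner product of z and w as points of the
  plane, so the exponential factors over the two coordinates of w.\<close>

lemma char_std_complex_normal:
  "(CLINT w|std_complex_normal. iexp (Re (cnj z * w))) = complex_of_real (exp (- (cmod z)\<^sup>2 / 4))"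
proof -
  interpret pair_prob_space gauss_half gauss_half ..
  have "(CLINT w|std_complex_normal. iexp (Re (cnj z * w)))
      = (CLINT p|gauss_half \<Otimes>\<^sub>M gauss_half. iexp (Re z * fst p) * iexp (Im z * snd p))"
    unfolding std_complex_normal_eq_distr
    by (subst integral_distr)
       (auto simp: case_prod_unfold mult_exp_exp distrib_left intro!: Bochner_Integration.integral_cong)
  also have "\<dots> = complex_of_real (exp (- (Re z)\<^sup>2 / 4)) * complex_of_real (exp (- (Im z)\<^sup>2 / 4))"
    by (subst integral_pair_mult) (simp_all add: char_gauss_half del: of_real_mult)
  also have "\<dots> = complex_of_real (exp (- (cmod z)\<^sup>2 / 4))"
    by (simp add: cmod_power2 exp_add[symmetric] add_divide_distrib flip: of_real_mult)
  finally show ?thesis .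
qed

section \<open>Laplace transform and mean of the squared modulus\<close>

lemma gauss_half_laplace_square:
  "(\<integral>x. exp (- (u * x)\<^sup>2) \<partial>gauss_half) = 1 / sqrt (1 + u\<^sup>2)"
proof -
  \<comment> \<open>Chosen so that 1 / (2 \<sigma>^2) = 1 + u^2, the coefficient of -x^2 in
    exp(-x^2) exp(-(u x)^2). The integrand is then a multiple of a normal density, and the multiple
    is the value sought.\<close>
  define \<sigma> where "\<sigma> = 1 / sqrt (2 * (1 + u\<^sup>2))"
  have pos: "1 + u\<^sup>2 > 0" by (simp add: add_pos_nonneg)
  have \<sigma>: "\<sigma> > 0" "2 * \<sigma>\<^sup>2 = 1 / (1 + u\<^sup>2)" "2 * pi * \<sigma>\<^sup>2 = pi / (1 + u\<^sup>2)"
    using pos by (simp_all add: \<sigma>_def power_divide del: distrib_left_numeral)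
  have dens: "normal_density 0 \<sigma> x = sqrt (1 + u\<^sup>2) * exp (- (1 + u\<^sup>2) * x\<^sup>2) / sqrt pi" for x
    unfolding normal_density_def \<sigma>(2,3) by (simp add: real_sqrt_divide algebra_simps)
  have "(\<integral>x. exp (- (u * x)\<^sup>2) \<partial>gauss_half)
      = (\<integral>x. normal_density 0 (1 / sqrt 2) x * exp (- (u * x)\<^sup>2) \<partial>lborel)"
    unfolding gauss_half_def by (subst integral_density) auto
  also have "\<dots> = (\<integral>x. 1 / sqrt (1 + u\<^sup>2) * normal_density 0 \<sigma> x \<partial>lborel)"
    using pos
    by (intro Bochner_Integration.integral_cong) (simp_all add: normal_density_half dens mult_exp_exp algebra_simps)
  also have "\<dots> = 1 / sqrt (1 + u\<^sup>2)"
    using \<sigma>(1) by simp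
  finally show ?thesis .
qed

lemma std_complex_normal_laplace_square:
  "(\<integral>w. exp (- (u * cmod w)\<^sup>2) \<partial>std_complex_normal) = 1 / (1 + u\<^sup>2)"
proof -
  interpret pair_prob_space gauss_half gauss_half ..
  have "(\<integral>w. exp (- (u * cmod w)\<^sup>2) \<partial>std_complex_normal)
      = (\<integral>p. exp (- (u * fst p)\<^sup>2) * exp (- (u * snd p)\<^sup>2) \<partial>(gauss_half \<Otimes>\<^sub>M gauss_half))"
    unfolding std_complex_normal_eq_distr
    by (subst integral_distr)
       (auto simp: case_prod_unfold mult_exp_exp power_mult_distrib cmod_power2 algebra_simps intro!: Bochner_Integration.integral_cong)
  also have "\<dots> = 1 / sqrt (1 + u\<^sup>2) * (1 / sqrt (1 + u\<^sup>2))"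
    by (subst integral_pair_mult) (auto simp: gauss_half_laplace_square)
  finally show ?thesis by (simp add: add_pos_nonneg)
qed

lemma std_complex_normal_second_moment:
  "has_bochner_integral std_complex_normal (\<lambda>w. (cmod w)\<^sup>2) 1"
proof -
  interpret pair_prob_space gauss_half gauss_half ..
  have sq: "has_bochner_integral gauss_half (\<lambda>x. x\<^sup>2) (1 / 2)"
    using normal_moment_even[of "1 / sqrt 2" 0 1]
    by (auto simp: gauss_half_def has_bochner_integral_density power_divide)
  have sq_nn: "(\<integral>\<^sup>+x. ennreal (x\<^sup>2) \<partial>gauss_half) = ennreal (1 / 2)"
    using sq by (subst nn_integral_eq_integral) (auto simp: has_bochner_integral_iff simp del: ennreal_half)
  \<comment> \<open>Nonnegative integrals allow the product measure to be split without proving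
    integrability first; it is recovered at the end from finiteness.\<close>
  have "(\<integral>\<^sup>+w. ennreal ((cmod w)\<^sup>2) \<partial>std_complex_normal)
      = (\<integral>\<^sup>+p. ennreal ((fst p)\<^sup>2) + ennreal ((snd p)\<^sup>2) \<partial>(gauss_half \<Otimes>\<^sub>M gauss_half))"
    unfolding std_complex_normal_eq_distr
    by (subst nn_integral_distr)
       (auto simp: case_prod_unfold cmod_power2 intro!: nn_integral_cong)
  also have "\<dots> = (\<integral>\<^sup>+x. \<integral>\<^sup>+y. ennreal (x\<^sup>2) + ennreal (y\<^sup>2) \<partial>gauss_half \<partial>gauss_half)"
    by (subst gauss_half.nn_integral_fst[symmetric]) auto
  also have "\<dots> = ennreal (1 / 2) + ennreal (1 / 2)"
    by (simp add: nn_integral_add sq_nn gauss_half.emeasure_space_1[simplified])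
  also have "\<dots> = ennreal 1"
    by (subst ennreal_plus[symmetric]) auto
  finally show ?thesis
    by (intro has_bochner_integral_nn_integral) auto
qed

subsection \<open>Absolute moments from Gaussian Laplace transforms\<close>

lemma measurable_cnj [measurable]: "cnj \<in> borel_measurable borel"
  by (intro borel_measurable_continuous_onI continuous_intros)

text \<open>The point 0 is Lebesgue null. This permits passing between the closed and the open
  half-line and ignoring a degenerate parameter value 0.\<close>

lemma nn_integral_lborel_cong_nonzero:
  fixes f g :: "real \<Rightarrow> ennreal"
  assumes "\<And>x. x \<noteq> 0 \<Longrightarrow> f x = g x"
  shows "(\<integral>\<^sup>+x. f x \<partial>lborel) = (\<integral>\<^sup>+x. g x \<partial>lborel)"
  by (rule nn_integral_cong_AE) (use AE_lborel_singleton[of 0] assms in \<open>auto elim!: eventually_mono\<close>)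

lemma nn_integral_gaussian_half_line:
  assumes "s > 0"
  shows "(\<integral>\<^sup>+u. ennreal (exp (- (u * s)\<^sup>2)) * indicator {0..} u \<partial>lborel) = ennreal (sqrt pi / (2 * s))"
proof -
  have "ennreal (sqrt pi / 2) = (\<integral>\<^sup>+x. ennreal (indicator {0..} x *\<^sub>R exp (- x\<^sup>2)) \<partial>lborel)"
    using gaussian_moment_0
    by (subst nn_integral_eq_integral) (auto simp: has_bochner_integral_iff)
  also have "\<dots> = ennreal s * (\<integral>\<^sup>+u. ennreal (indicator {0..} (s * u) *\<^sub>R exp (- (s * u)\<^sup>2)) \<partial>lborel)"
    using assms by (subst nn_integral_real_affine[where c = s and t = 0]) auto
  also have "(\<integral>\<^sup>+u. ennreal (indicator {0..} (s * u) *\<^sub>R exp (- (s * u)\<^sup>2)) \<partial>lborel)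
      = (\<integral>\<^sup>+u. ennreal (exp (- (u * s)\<^sup>2)) * indicator {0..} u \<partial>lborel)"
    using assms
    by (intro nn_integral_cong) (auto split: split_indicator simp: zero_le_mult_iff mult.commute)
  finally have *: "ennreal s * (\<integral>\<^sup>+u. ennreal (exp (- (u * s)\<^sup>2)) * indicator {0..} u \<partial>lborel) = ennreal (sqrt pi / 2)" ..
  \<comment> \<open>The integral is not yet known to be finite, so the factor s is removed by
    multiplying with its inverse inside \<open>ennreal\<close>. The same device is used for the
    moments below.\<close>
  have "(\<integral>\<^sup>+u. ennreal (exp (- (u * s)\<^sup>2)) * indicator {0..} u \<partial>lborel)
      = ennreal (1 / s) * (ennreal s * (\<integral>\<^sup>+u. ennreal (exp (- (u * s)\<^sup>2)) * indicator {0..} u \<partial>lborel))"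
    using assms by (simp add: mult.assoc[symmetric] ennreal_mult[symmetric])
  also have "\<dots> = ennreal (sqrt pi / (2 * s))"
    unfolding * using assms by (simp add: ennreal_mult[symmetric] field_simps)
  finally show ?thesis .
qed

text \<open>The integrand that represents \<open>sqrt pi * r\<close> as an integral over u > 0. It
  is nonnegative, so Tonelli's theorem applies, and r enters only through exp(-(u r)^2), that is,
  through the Laplace transform of r^2.\<close>

definition abs_kernel :: "real \<Rightarrow> real \<Rightarrow> real" where
  "abs_kernel u r = indicator {0<..} u * ((1 - exp (- (u * r)\<^sup>2)) / u\<^sup>2)"

lemma abs_kernel_nonneg [simp]: "0 \<le> abs_kernel u r"
  by (simp add: abs_kernel_def)

lemma measurable_abs_kernel [measurable]:
  "(\<lambda>(u, r). abs_kernel u r) \<in> borel_measurable (borel \<Otimes>\<^sub>M borel)"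
  unfolding abs_kernel_def by measurable

text \<open>For u > 0 the kernel is the integral of 2 s exp(-(u s)^2) over s in [0, r]. Exchanging
  the integrals leaves 2 s times the Gaussian integral sqrt pi / (2 s), which is the constant sqrt
  pi, on an interval of length r.\<close>

lemma nn_integral_abs_kernel:
  assumes "r \<ge> 0"
  shows "(\<integral>\<^sup>+u. ennreal (abs_kernel u r) \<partial>lborel) = ennreal (sqrt pi * r)"
proof -
  let ?f = "\<lambda>u s. ennreal (2 * s * exp (- (u * s)\<^sup>2)) * indicator {0..r} s * indicator {0<..} u :: ennreal"
  have "(\<integral>\<^sup>+u. ennreal (abs_kernel u r) \<partial>lborel) = (\<integral>\<^sup>+u. \<integral>\<^sup>+s. ?f u s \<partial>lborel \<partial>lborel)"
  proof (rule nn_integral_cong)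
    fix u :: real
    show "ennreal (abs_kernel u r) = (\<integral>\<^sup>+s. ?f u s \<partial>lborel)"
    proof (cases "u > 0")
      case True
      have "(\<integral>\<^sup>+s. ennreal (2 * s * exp (- (u * s)\<^sup>2)) * indicator {0..r} s \<partial>lborel)
          = ennreal ((- exp (- (u * r)\<^sup>2) / u\<^sup>2) - (- exp (- (u * 0)\<^sup>2) / u\<^sup>2))"
        using True assms
        by (intro nn_integral_FTC_Icc)
           (auto intro!: derivative_eq_intros simp: field_simps power2_eq_square)
      with True show ?thesis
        by (simp add: abs_kernel_def diff_divide_distrib)
    qed (simp add: abs_kernel_def)
  qed
  also have "\<dots> = (\<integral>\<^sup>+s. \<integral>\<^sup>+u. ?f u s \<partial>lborel \<partial>lborel)"
    by (rule lborel_pair.Fubini') simp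
  \<comment> \<open>At s = 0 the inner integral is 0 instead of sqrt pi, so the integrands agree
    only almost everywhere.\<close>
  also have "\<dots> = (\<integral>\<^sup>+s. ennreal (sqrt pi) * indicator {0..r} s \<partial>lborel)"
  proof (rule nn_integral_lborel_cong_nonzero)
    fix s :: real assume "s \<noteq> 0"
    show "(\<integral>\<^sup>+u. ?f u s \<partial>lborel) = ennreal (sqrt pi) * indicator {0..r} s"
    proof (cases "0 \<le> s \<and> s \<le> r")
      case True
      with \<open>s \<noteq> 0\<close> have "s > 0" by simp
      have "(\<integral>\<^sup>+u. ?f u s \<partial>lborel)
          = (\<integral>\<^sup>+u. ennreal (2 * s) * (ennreal (exp (- (u * s)\<^sup>2)) * indicator {0..} u) \<partial>lborel)"
        using True \<open>s > 0\<close>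
        by (intro nn_integral_lborel_cong_nonzero)
           (auto split: split_indicator simp: ennreal_mult)
      also have "\<dots> = ennreal (2 * s) * ennreal (sqrt pi / (2 * s))"
        by (subst nn_integral_cmult) (auto simp: nn_integral_gaussian_half_line[OF \<open>s > 0\<close>])
      also have "\<dots> = ennreal (sqrt pi)"
        using \<open>s > 0\<close> by (simp add: ennreal_mult[symmetric])
      finally show ?thesis using True by simp
    qed auto
  qed
  also have "\<dots> = ennreal (sqrt pi * r)"
    using assms by (simp add: nn_integral_cmult_indicator ennreal_mult)
  finally show ?thesis .
qed

lemma nn_integral_cauchy_half_line:
  "(\<integral>\<^sup>+u. ennreal (indicator {0<..} u * (1 / (1 + u\<^sup>2))) \<partial>lborel) = ennreal (pi / 2)"
proof -
  have "(\<integral>\<^sup>+u. ennreal (indicator {0<..} u * (1 / (1 + u\<^sup>2))) \<partial>lborel)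
      = (\<integral>\<^sup>+u. ennreal (1 / (1 + u\<^sup>2)) * indicator {0..} u \<partial>lborel)"
    by (intro nn_integral_lborel_cong_nonzero)
       (auto split: split_indicator)
  also have "\<dots> = ennreal (pi / 2 - arctan 0)"
    by (intro nn_integral_FTC_atLeast tendsto_arctan_at_top)
       (auto intro!: derivative_eq_intros simp: add_nonneg_eq_0_iff divide_inverse)
  finally show ?thesis by simp
qed

lemma abs_kernel_measurable_rv [measurable (raw)]:
  assumes "f \<in> borel_measurable M" "g \<in> borel_measurable M"
  shows "(\<lambda>x. abs_kernel (f x) (g x)) \<in> borel_measurable M"
  using measurable_compose[OF measurable_Pair[OF assms] measurable_abs_kernel] by simp

lemma one_minus_inverse_one_plus_square: "1 - 1 / (1 + u\<^sup>2) = u\<^sup>2 / (1 + u\<^sup>2)" for u :: real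
proof -
  have "1 + u\<^sup>2 \<noteq> 0" by (simp add: add_nonneg_eq_0_iff)
  then show ?thesis by (simp add: diff_divide_eq_iff)
qed

text \<open>\<open>L\<close> says that X^2 has the Laplace transform of the exponential law of mean
  1. Averaging the kernel gives (1 - 1 / (1 + u^2)) / u^2, which is 1 / (1 + u^2) again and
  integrates to pi / 2 over u > 0.\<close>

lemma (in prob_space) expectation_abs_kernel:
  assumes [measurable]: "X \<in> borel_measurable M"
    and L: "\<And>u. expectation (\<lambda>\<omega>. exp (- (u * X \<omega>)\<^sup>2)) = 1 / (1 + u\<^sup>2)"
  shows "(\<integral>\<^sup>+\<omega>. ennreal (abs_kernel u (X \<omega>)) \<partial>M) = ennreal (indicator {0<..} u * (1 / (1 + u\<^sup>2)))"
proof (cases "u > 0")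
  case True
  have int: "integrable M (\<lambda>\<omega>. exp (- (u * X \<omega>)\<^sup>2))"
    by (rule integrable_const_bound[where B = 1]) auto
  have "(\<integral>\<^sup>+\<omega>. ennreal (abs_kernel u (X \<omega>)) \<partial>M) = ennreal (expectation (\<lambda>\<omega>. abs_kernel u (X \<omega>)))"
    using int by (intro nn_integral_eq_integral) (auto simp: abs_kernel_def)
  also have "expectation (\<lambda>\<omega>. abs_kernel u (X \<omega>)) = (1 - 1 / (1 + u\<^sup>2)) / u\<^sup>2"
    using int True by (simp add: abs_kernel_def L prob_space)
  also have "\<dots> = 1 / (1 + u\<^sup>2)"
    unfolding one_minus_inverse_one_plus_square using True by simp
  finally show ?thesis using True by simp
qed (simp add: abs_kernel_def)

text \<open>Expanding the product of the kernels leaves only the joint transform and its marginals,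
  so the factorised transform \<open>L\<close> takes the place of independence of X and Y.\<close>

lemma (in prob_space) expectation_abs_kernel_mult:
  assumes [measurable]: "X \<in> borel_measurable M" "Y \<in> borel_measurable M"
    and L: "\<And>u v. expectation (\<lambda>\<omega>. exp (- (u * X \<omega>)\<^sup>2) * exp (- (v * Y \<omega>)\<^sup>2)) = 1 / (1 + u\<^sup>2) * (1 / (1 + v\<^sup>2))"
  shows "(\<integral>\<^sup>+\<omega>. ennreal (abs_kernel u (X \<omega>)) * ennreal (abs_kernel v (Y \<omega>)) \<partial>M)
    = ennreal (indicator {0<..} u * (1 / (1 + u\<^sup>2))) * ennreal (indicator {0<..} v * (1 / (1 + v\<^sup>2)))"
proof (cases "u > 0 \<and> v > 0")
  case True
  let ?X = "\<lambda>\<omega>. exp (- (u * X \<omega>)\<^sup>2)" and ?Y = "\<lambda>\<omega>. exp (- (v * Y \<omega>)\<^sup>2)"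
  have int: "integrable M ?X" "integrable M ?Y" "integrable M (\<lambda>\<omega>. ?X \<omega> * ?Y \<omega>)"
    by (rule integrable_const_bound[where B = 1]; auto intro!: mult_le_one)+
  have eq: "abs_kernel u (X \<omega>) * abs_kernel v (Y \<omega>) = (1 - ?X \<omega> - ?Y \<omega> + ?X \<omega> * ?Y \<omega>) / (u\<^sup>2 * v\<^sup>2)" for \<omega>
    using True by (simp add: abs_kernel_def algebra_simps)
  have "(\<integral>\<^sup>+\<omega>. ennreal (abs_kernel u (X \<omega>)) * ennreal (abs_kernel v (Y \<omega>)) \<partial>M)
      = ennreal (expectation (\<lambda>\<omega>. abs_kernel u (X \<omega>) * abs_kernel v (Y \<omega>)))"
    unfolding ennreal_mult[symmetric, OF abs_kernel_nonneg abs_kernel_nonneg]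
    by (intro nn_integral_eq_integral) (use int in \<open>auto simp: eq intro!: AE_I2\<close>, simp flip: eq)
  also have "expectation (\<lambda>\<omega>. abs_kernel u (X \<omega>) * abs_kernel v (Y \<omega>))
      = (1 - 1 / (1 + u\<^sup>2) - 1 / (1 + v\<^sup>2) + 1 / (1 + u\<^sup>2) * (1 / (1 + v\<^sup>2))) / (u\<^sup>2 * v\<^sup>2)"
    \<comment> \<open>Setting one parameter of the joint transform to 0 yields the marginal
      transform of the other variable.\<close>
    unfolding eq using int L[of u 0] L[of 0 v] L[of u v] by (simp add: prob_space)
  also have "\<dots> = ((1 - 1 / (1 + u\<^sup>2)) * (1 - 1 / (1 + v\<^sup>2))) / (u\<^sup>2 * v\<^sup>2)"
    by (simp add: algebra_simps)
  also have "\<dots> = 1 / (1 + u\<^sup>2) * (1 / (1 + v\<^sup>2))"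
    unfolding one_minus_inverse_one_plus_square using True by simp
  finally show ?thesis using True by (simp add: ennreal_mult[symmetric])
qed (auto simp: abs_kernel_def)

text \<open>By Tonelli, sqrt pi times the mean of X is the integral over u of the averaged kernel,
  which is pi / 2.\<close>

lemma (in prob_space) nn_expectation_of_laplace_square:
  assumes [measurable]: "X \<in> borel_measurable M" and "\<And>\<omega>. X \<omega> \<ge> 0"
    and L: "\<And>u. expectation (\<lambda>\<omega>. exp (- (u * X \<omega>)\<^sup>2)) = 1 / (1 + u\<^sup>2)"
  shows "(\<integral>\<^sup>+\<omega>. ennreal (X \<omega>) \<partial>M) = ennreal (sqrt pi / 2)"
proof -
  interpret pair_sigma_finite M lborel ..
  have "ennreal (sqrt pi) * (\<integral>\<^sup>+\<omega>. ennreal (X \<omega>) \<partial>M) = (\<integral>\<^sup>+\<omega>. \<integral>\<^sup>+u. ennreal (abs_kernel u (X \<omega>)) \<partial>lborel \<partial>M)"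
    by (simp add: nn_integral_abs_kernel assms(2) ennreal_mult nn_integral_cmult)
  also have "\<dots> = (\<integral>\<^sup>+u. \<integral>\<^sup>+\<omega>. ennreal (abs_kernel u (X \<omega>)) \<partial>M \<partial>lborel)"
    by (rule Fubini'[symmetric]) measurable
  also have "\<dots> = ennreal (pi / 2)"
    unfolding expectation_abs_kernel[OF assms(1) L] by (rule nn_integral_cauchy_half_line)
  finally have *: "ennreal (sqrt pi) * (\<integral>\<^sup>+\<omega>. ennreal (X \<omega>) \<partial>M) = ennreal (pi / 2)" .
  have "(\<integral>\<^sup>+\<omega>. ennreal (X \<omega>) \<partial>M) = ennreal (1 / sqrt pi) * (ennreal (sqrt pi) * (\<integral>\<^sup>+\<omega>. ennreal (X \<omega>) \<partial>M))"
    by (simp add: mult.assoc[symmetric] ennreal_mult[symmetric])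
  also have "\<dots> = ennreal (sqrt pi / 2)"
    unfolding * by (simp add: ennreal_mult[symmetric] real_div_sqrt)
  finally show ?thesis .
qed

text \<open>With one kernel for each factor, pi times the mean of X Y is a double integral over u
  and v that splits into (pi / 2)^2.\<close>

lemma (in prob_space) nn_expectation_mult_of_laplace_square:
  assumes [measurable]: "X \<in> borel_measurable M" "Y \<in> borel_measurable M"
    and "\<And>\<omega>. X \<omega> \<ge> 0" "\<And>\<omega>. Y \<omega> \<ge> 0"
    and L: "\<And>u v. expectation (\<lambda>\<omega>. exp (- (u * X \<omega>)\<^sup>2) * exp (- (v * Y \<omega>)\<^sup>2)) = 1 / (1 + u\<^sup>2) * (1 / (1 + v\<^sup>2))"
  shows "(\<integral>\<^sup>+\<omega>. ennreal (X \<omega> * Y \<omega>) \<partial>M) = ennreal (pi / 4)"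
proof -
  interpret pair_sigma_finite M lborel ..
  let ?k = "\<lambda>u r. ennreal (abs_kernel u r)"
  have "ennreal pi * (\<integral>\<^sup>+\<omega>. ennreal (X \<omega> * Y \<omega>) \<partial>M) = (\<integral>\<^sup>+\<omega>. ennreal (sqrt pi * X \<omega>) * ennreal (sqrt pi * Y \<omega>) \<partial>M)"
    by (subst nn_integral_cmult[symmetric], simp)
       (auto intro!: nn_integral_cong simp: ennreal_mult[symmetric] assms(3,4) mult.assoc mult.left_commute)
  also have "\<dots> = (\<integral>\<^sup>+\<omega>. (\<integral>\<^sup>+u. ?k u (X \<omega>) * (\<integral>\<^sup>+v. ?k v (Y \<omega>) \<partial>lborel) \<partial>lborel) \<partial>M)"
    by (simp add: nn_integral_multc nn_integral_abs_kernel assms(3,4))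
  \<comment> \<open>The expectation is moved inwards in two exchanges: first past u, with the
    v-integral kept as a factor, then past v for each fixed u.\<close>
  also have "\<dots> = (\<integral>\<^sup>+u. (\<integral>\<^sup>+\<omega>. ?k u (X \<omega>) * (\<integral>\<^sup>+v. ?k v (Y \<omega>) \<partial>lborel) \<partial>M) \<partial>lborel)"
    by (rule Fubini'[symmetric]) measurable
  also have "\<dots> = (\<integral>\<^sup>+u. (\<integral>\<^sup>+\<omega>. (\<integral>\<^sup>+v. ?k u (X \<omega>) * ?k v (Y \<omega>) \<partial>lborel) \<partial>M) \<partial>lborel)"
    by (simp add: nn_integral_cmult)
  also have "\<dots> = (\<integral>\<^sup>+u. (\<integral>\<^sup>+v. (\<integral>\<^sup>+\<omega>. ?k u (X \<omega>) * ?k v (Y \<omega>) \<partial>M) \<partial>lborel) \<partial>lborel)"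
    by (intro nn_integral_cong Fubini'[symmetric]) measurable
  also have "\<dots> = ennreal (pi / 2) * ennreal (pi / 2)"
    unfolding expectation_abs_kernel_mult[OF assms(1,2) L] nn_integral_cauchy_half_line[symmetric]
    by (subst nn_integral_cmult, simp, subst nn_integral_multc) simp_all
  finally have *: "ennreal pi * (\<integral>\<^sup>+\<omega>. ennreal (X \<omega> * Y \<omega>) \<partial>M) = ennreal (pi / 2) * ennreal (pi / 2)" .
  have "(\<integral>\<^sup>+\<omega>. ennreal (X \<omega> * Y \<omega>) \<partial>M) = ennreal (1 / pi) * (ennreal pi * (\<integral>\<^sup>+\<omega>. ennreal (X \<omega> * Y \<omega>) \<partial>M))"
    by (simp add: mult.assoc[symmetric] ennreal_mult[symmetric])
  also have "\<dots> = ennreal (pi / 4)"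
    unfolding * by (simp add: ennreal_mult[symmetric])
  finally show ?thesis .
qed

text \<open>Two auxiliary independent CN(0,1) variables linearise the squared moduli. After Fubini
  they act as the coefficients c and d in \<open>char\<close>, and the remaining integral is the
  Laplace transform of their own squared moduli.\<close>

lemma (in prob_space) laplace_square_cmod_of_char:
  assumes [measurable]: "X \<in> borel_measurable M" "Y \<in> borel_measurable M"
    and char: "\<And>c d. (CLINT \<omega>|M. iexp (Re (cnj c * X \<omega> + cnj d * Y \<omega>)))
      = complex_of_real (exp (- ((cmod c)\<^sup>2 + (cmod d)\<^sup>2) / 4))"
  shows "expectation (\<lambda>\<omega>. exp (- (u * cmod (X \<omega>))\<^sup>2) * exp (- (v * cmod (Y \<omega>))\<^sup>2)) = 1 / (1 + u\<^sup>2) * (1 / (1 + v\<^sup>2))"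
proof -
  let ?W = "std_complex_normal"
  interpret WW: pair_prob_space ?W ?W ..
  interpret MW: pair_prob_space M "?W \<Otimes>\<^sub>M ?W" ..
  \<comment> \<open>The characteristic function at z is exp(-|z|^2 / 4), hence the argument z = 2 u
    x.\<close>
  have exp_char: "complex_of_real (exp (- (u * cmod x)\<^sup>2)) = (CLINT w|?W. iexp (Re (cnj (complex_of_real (2 * u) * x) * w)))" for u x
    unfolding char_std_complex_normal by (simp add: norm_mult power_mult_distrib)
  define f where "f = (\<lambda>\<omega> q. iexp (Re (cnj (complex_of_real (2 * u) * fst q) * X \<omega> + cnj (complex_of_real (2 * v) * snd q) * Y \<omega>)))"
  have [measurable]: "(\<lambda>(\<omega>, q). f \<omega> q) \<in> borel_measurable (M \<Otimes>\<^sub>M (?W \<Otimes>\<^sub>M ?W))"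
    unfolding f_def by measurable
  have "complex_of_real (expectation (\<lambda>\<omega>. exp (- (u * cmod (X \<omega>))\<^sup>2) * exp (- (v * cmod (Y \<omega>))\<^sup>2)))
      = (CLINT \<omega>|M. complex_of_real (exp (- (u * cmod (X \<omega>))\<^sup>2)) * complex_of_real (exp (- (v * cmod (Y \<omega>))\<^sup>2)))"
    by (simp flip: integral_complex_of_real)
  \<comment> \<open>The real part of cnj x * w is symmetric in x and w, so the exponent can be
    written with the conjugate on the auxiliary variable, the form required by
    \<open>char\<close>.\<close>
  also have "\<dots> = (CLINT \<omega>|M. CLINT q|?W \<Otimes>\<^sub>M ?W. f \<omega> q)"
    unfolding exp_char
    by (subst WW.integral_pair_mult[symmetric])
       (auto simp: f_def mult_exp_exp algebra_simps intro!: Bochner_Integration.integral_cong)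
  also have "\<dots> = (CLINT q|?W \<Otimes>\<^sub>M ?W. CLINT \<omega>|M. f \<omega> q)"
    by (rule MW.Fubini_integral[symmetric], rule MW.integrable_const_bound[where B = 1])
       (auto simp: f_def)
  also have "\<dots> = (CLINT q|?W \<Otimes>\<^sub>M ?W. complex_of_real (exp (- (u * cmod (fst q))\<^sup>2) * exp (- (v * cmod (snd q))\<^sup>2)))"
    unfolding f_def char
    by (intro Bochner_Integration.integral_cong)
       (auto simp: norm_mult power_mult_distrib mult_exp_exp add_divide_distrib)
  also have "\<dots> = complex_of_real (1 / (1 + u\<^sup>2) * (1 / (1 + v\<^sup>2)))"
    unfolding integral_complex_of_real
    by (subst WW.integral_pair_mult) (auto simp: std_complex_normal_laplace_square)
  finally show ?thesis
    by (simp only: of_real_eq_iff)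
qed

subsection \<open>Complex normal vectors\<close>

lemma nn_integral_cmod_std_complex_normal:
  "(\<integral>\<^sup>+w. ennreal (cmod w) \<partial>std_complex_normal) = ennreal (sqrt pi / 2)"
  by (rule std_complex_normal.nn_expectation_of_laplace_square)
     (simp_all add: std_complex_normal_laplace_square)

lemma emeasure_std_complex_normal_0: "emeasure std_complex_normal {0} = 0"
  unfolding std_complex_normal_def by (subst emeasure_density) (simp_all add: nn_integral_indicator_singleton')

definition lin_comb :: "'i set \<Rightarrow> ('i \<Rightarrow> complex) \<Rightarrow> ('i \<Rightarrow> 'w \<Rightarrow> complex) \<Rightarrow> 'w \<Rightarrow> complex" where
  "lin_comb I c X \<omega> = (\<Sum>i\<in>I. cnj (c i) * X i \<omega>)"

text \<open>The variance parameter c^H R c of \<open>lin_comb I c X\<close>, written with the real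
  part exactly as in \<open>complex_normal_vector\<close>.\<close>

definition herm_form :: "'i set \<Rightarrow> ('i \<Rightarrow> complex) \<Rightarrow> ('i \<Rightarrow> 'i \<Rightarrow> complex) \<Rightarrow> real" where
  "herm_form I c R = Re (\<Sum>i\<in>I. \<Sum>j\<in>I. cnj (c i) * R i j * c j)"

context
  fixes P :: "'w measure" and I :: "'i set" and X :: "'i \<Rightarrow> 'w \<Rightarrow> complex" and R :: "'i \<Rightarrow> 'i \<Rightarrow> complex"
  assumes normal: "complex_normal_vector P I X R"
begin

lemma complex_normal_vector_measurable: "i \<in> I \<Longrightarrow> X i \<in> borel_measurable P"
  using normal by (simp add: complex_normal_vector_def)

text \<open>Moments, characteristic functions and null events of a linear combination are all
  transported to the scalar CN(0,1) law through this equality of laws.\<close>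

lemma complex_normal_vector_distr:
  "distr P borel (lin_comb I c X)
    = distr std_complex_normal borel (\<lambda>w. complex_of_real (sqrt (herm_form I c R)) * w)"
  using normal by (simp add: complex_normal_vector_def lin_comb_def[abs_def] herm_form_def)

lemma lin_comb_measurable [measurable]: "lin_comb I c X \<in> borel_measurable P"
  unfolding lin_comb_def[abs_def]
  by (intro borel_measurable_sum borel_measurable_times borel_measurable_const complex_normal_vector_measurable)

lemma nn_integral_lin_comb:
  assumes [measurable]: "f \<in> borel_measurable borel"
  shows "(\<integral>\<^sup>+\<omega>. f (lin_comb I c X \<omega>) \<partial>P)
    = (\<integral>\<^sup>+w. f (complex_of_real (sqrt (herm_form I c R)) * w) \<partial>std_complex_normal)"
  using nn_integral_distr[of "lin_comb I c X" P borel f]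
  by (simp add: complex_normal_vector_distr nn_integral_distr)

lemma integral_lin_comb:
  fixes f :: "complex \<Rightarrow> 'b::{banach, second_countable_topology}"
  assumes [measurable]: "f \<in> borel_measurable borel"
  shows "(\<integral>\<omega>. f (lin_comb I c X \<omega>) \<partial>P)
    = (\<integral>w. f (complex_of_real (sqrt (herm_form I c R)) * w) \<partial>std_complex_normal)"
  using integral_distr[of "lin_comb I c X" P borel f]
  by (simp add: complex_normal_vector_distr integral_distr)

lemma has_bochner_integral_cmod_lin_comb:
  assumes "herm_form I c R \<ge> 0"
  shows "has_bochner_integral P (\<lambda>\<omega>. cmod (lin_comb I c X \<omega>)) (sqrt pi / 2 * sqrt (herm_form I c R))"
proof (rule has_bochner_integral_nn_integral)
  have "(\<integral>\<^sup>+\<omega>. ennreal (cmod (lin_comb I c X \<omega>)) \<partial>P)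
      = (\<integral>\<^sup>+w. ennreal (sqrt (herm_form I c R)) * ennreal (cmod w) \<partial>std_complex_normal)"
    using assms by (subst nn_integral_lin_comb) (simp_all add: norm_mult ennreal_mult)
  also have "\<dots> = ennreal (sqrt pi / 2 * sqrt (herm_form I c R))"
    using assms by (subst nn_integral_cmult)
       (simp_all add: nn_integral_cmod_std_complex_normal ennreal_mult[symmetric] mult.commute)
  finally show "(\<integral>\<^sup>+\<omega>. ennreal (cmod (lin_comb I c X \<omega>)) \<partial>P) = ennreal (sqrt pi / 2 * sqrt (herm_form I c R))" .
qed (use assms in auto)

lemma has_bochner_integral_cmod_lin_comb_square:
  assumes "herm_form I c R \<ge> 0"
  shows "has_bochner_integral P (\<lambda>\<omega>. (cmod (lin_comb I c X \<omega>))\<^sup>2) (herm_form I c R)"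
proof (rule has_bochner_integral_nn_integral)
  have 1: "(\<integral>\<^sup>+w. ennreal ((cmod w)\<^sup>2) \<partial>std_complex_normal) = ennreal 1"
    using std_complex_normal_second_moment
    by (subst nn_integral_eq_integral) (auto simp: has_bochner_integral_iff)
  have "(\<integral>\<^sup>+\<omega>. ennreal ((cmod (lin_comb I c X \<omega>))\<^sup>2) \<partial>P)
      = (\<integral>\<^sup>+w. ennreal (herm_form I c R) * ennreal ((cmod w)\<^sup>2) \<partial>std_complex_normal)"
    using assms by (subst nn_integral_lin_comb) (simp_all add: norm_mult ennreal_mult power_mult_distrib)
  also have "\<dots> = ennreal (herm_form I c R)"
    using assms by (subst nn_integral_cmult) (simp_all add: 1)
  finally show "(\<integral>\<^sup>+\<omega>. ennreal ((cmod (lin_comb I c X \<omega>))\<^sup>2) \<partial>P) = ennreal (herm_form I c R)" .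
qed (use assms in auto)

lemma char_lin_comb:
  assumes "herm_form I c R \<ge> 0"
  shows "(CLINT \<omega>|P. iexp (Re (lin_comb I c X \<omega>))) = complex_of_real (exp (- herm_form I c R / 4))"
  using char_std_complex_normal[of "complex_of_real (sqrt (herm_form I c R))"] assms
  by (subst integral_lin_comb[where f = "\<lambda>z. iexp (Re z)"]) simp_all

lemma AE_lin_comb_nonzero:
  assumes "herm_form I c R > 0"
  shows "AE \<omega> in P. lin_comb I c X \<omega> \<noteq> 0"
proof -
  have "AE z in distr P borel (lin_comb I c X). z \<noteq> 0"
    unfolding complex_normal_vector_distr using assms
    by (subst AE_distr_iff) (auto intro!: AE_I[where N = "{0}"] simp: emeasure_std_complex_normal_0)
  then show ?thesis
    by (subst (asm) AE_distr_iff) auto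
qed

text \<open>With variance 0 the scaled CN(0,1) law is the point mass at 0. Full correlation enters
  the proof through this case.\<close>

lemma AE_lin_comb_eq_0:
  assumes "herm_form I c R = 0"
  shows "AE \<omega> in P. lin_comb I c X \<omega> = 0"
proof -
  have "AE z in distr P borel (lin_comb I c X). z = 0"
    unfolding complex_normal_vector_distr assms
    by (subst AE_distr_iff) auto
  then show ?thesis
    by (subst (asm) AE_distr_iff) auto
qed

end

section \<open>Cross moments of two components\<close>

lemma sum_eq_two_terms:
  fixes f :: "'i \<Rightarrow> 'b::comm_monoid_add"
  assumes "finite I" "m \<in> I" "n \<in> I" "m \<noteq> n" "\<And>i. i \<in> I \<Longrightarrow> i \<noteq> m \<Longrightarrow> i \<noteq> n \<Longrightarrow> f i = 0"
  shows "sum f I = f m + f n"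
  using sum.mono_neutral_right[of I "{m, n}" f] assms by auto

text \<open>A coefficient vector supported on two distinct indices: the model prescribes laws of
  combinations over all of I, and this one involves only two components.\<close>

definition pair_coeff :: "'i \<Rightarrow> 'i \<Rightarrow> complex \<Rightarrow> complex \<Rightarrow> 'i \<Rightarrow> complex" where
  "pair_coeff m n c d i = (if i = m then c else if i = n then d else 0)"

lemma lin_comb_pair:
  assumes "finite I" "m \<in> I" "n \<in> I" "m \<noteq> n"
  shows "lin_comb I (pair_coeff m n c d) X \<omega> = cnj c * X m \<omega> + cnj d * X n \<omega>"
  unfolding lin_comb_def by (subst sum_eq_two_terms[OF assms]) (use assms in \<open>auto simp: pair_coeff_def\<close>)

lemma herm_form_pair:
  assumes "finite I" "m \<in> I" "n \<in> I" "m \<noteq> n"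
  shows "herm_form I (pair_coeff m n c d) R
    = Re (cnj c * R m m * c + cnj c * R m n * d + cnj d * R n m * c + cnj d * R n n * d)"
proof -
  have "(\<Sum>j\<in>I. cnj (pair_coeff m n c d i) * R i j * pair_coeff m n c d j)
      = cnj (pair_coeff m n c d i) * R i m * c + cnj (pair_coeff m n c d i) * R i n * d" for i
    by (subst sum_eq_two_terms[OF assms]) (use assms in \<open>auto simp: pair_coeff_def\<close>)
  note inner = this
  have coeff: "pair_coeff m n c d m = c" "pair_coeff m n c d n = d"
    "\<And>i. i \<noteq> m \<Longrightarrow> i \<noteq> n \<Longrightarrow> pair_coeff m n c d i = 0"
    using assms by (auto simp: pair_coeff_def)
  show ?thesis
    unfolding herm_form_def inner
    by (subst sum_eq_two_terms[OF assms]) (use assms in \<open>simp_all add: coeff\<close>)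
qed

lemma lin_comb_single:
  assumes "finite I" "i \<in> I"
  shows "lin_comb I (\<lambda>j. if j = i then 1 else 0) X = X i"
proof
  fix \<omega>
  have "lin_comb I (\<lambda>j. if j = i then 1 else 0) X \<omega> = (\<Sum>j\<in>I. if j = i then X j \<omega> else 0)"
    unfolding lin_comb_def by (intro sum.cong) auto
  then show "lin_comb I (\<lambda>j. if j = i then 1 else 0) X \<omega> = X i \<omega>"
    using assms by simp
qed

lemma herm_form_single:
  assumes "finite I" "i \<in> I"
  shows "herm_form I (\<lambda>j. if j = i then 1 else 0) R = Re (R i i)"
proof -
  have "(\<Sum>k\<in>I. \<Sum>j\<in>I. cnj (if k = i then 1 else 0) * R k j * (if j = i then 1 else 0))
      = (\<Sum>k\<in>I. if k = i then R k i else 0)"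
    using assms by (intro sum.cong) (auto simp: if_distrib[of "\<lambda>x. _ * x"] cong: if_cong)
  then show ?thesis
    using assms by (simp add: herm_form_def)
qed

text \<open>The variance of a combination of two entries has no mixed term, so their joint
  characteristic function is that of two independent CN(0,1) variables; the Laplace transform
  argument then gives pi / 4.\<close>

lemma uncorrelated_cross_moment:
  assumes "prob_space P" and normal: "complex_normal_vector P I X uncorrelated"
    and I: "finite I" "m \<in> I" "n \<in> I" "m \<noteq> n"
  shows "has_bochner_integral P (\<lambda>\<omega>. cmod (X m \<omega>) * cmod (X n \<omega>)) (pi / 4)"
proof -
  interpret prob_space P by fact
  have [measurable]: "X m \<in> borel_measurable P" "X n \<in> borel_measurable P"
    using complex_normal_vector_measurable[OF normal] I by auto
  have "(CLINT \<omega>|P. iexp (Re (cnj c * X m \<omega> + cnj d * X n \<omega>)))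
      = complex_of_real (exp (- ((cmod c)\<^sup>2 + (cmod d)\<^sup>2) / 4))" for c d
  proof -
    have "herm_form I (pair_coeff m n c d) uncorrelated = (cmod c)\<^sup>2 + (cmod d)\<^sup>2"
      using I by (simp add: herm_form_pair uncorrelated_def cmod_power2) (simp add: power2_eq_square)
    then show ?thesis
      using char_lin_comb[OF normal, of "pair_coeff m n c d"] by (simp add: lin_comb_pair[OF I])
  qed
  then have "(\<integral>\<^sup>+\<omega>. ennreal (cmod (X m \<omega>) * cmod (X n \<omega>)) \<partial>P) = ennreal (pi / 4)"
    by (intro nn_expectation_mult_of_laplace_square laplace_square_cmod_of_char) simp_all
  then show ?thesis
    by (intro has_bochner_integral_nn_integral) auto
qed

text \<open>The difference of two entries has variance 1 - 1 - 1 + 1 = 0, so the entries agree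
  almost surely and the cross moment is a second moment.\<close>

lemma fully_correlated_cross_moment:
  assumes normal: "complex_normal_vector P I X fully_correlated"
    and I: "finite I" "m \<in> I" "n \<in> I" "m \<noteq> n"
  shows "has_bochner_integral P (\<lambda>\<omega>. cmod (X m \<omega>) * cmod (X n \<omega>)) 1"
proof -
  have [measurable]: "X m \<in> borel_measurable P" "X n \<in> borel_measurable P"
    using complex_normal_vector_measurable[OF normal] I by auto
  have "herm_form I (pair_coeff m n 1 (- 1)) fully_correlated = 0"
    using I by (simp add: herm_form_pair fully_correlated_def)
  from AE_lin_comb_eq_0[OF normal this] have eq: "AE \<omega> in P. X m \<omega> = X n \<omega>"
    by (simp add: lin_comb_pair[OF I])
  have "has_bochner_integral P (\<lambda>\<omega>. (cmod (X m \<omega>))\<^sup>2) 1"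
    using has_bochner_integral_cmod_lin_comb_square[OF normal, of "\<lambda>j. if j = m then 1 else 0"] I
    by (simp add: lin_comb_single herm_form_single fully_correlated_def)
  then show ?thesis
    by (rule has_bochner_integral_cong_AE[THEN iffD1, rotated 3])
       (use eq in \<open>auto simp: power2_eq_square\<close>)
qed

subsection \<open>The mean optimal SNR\<close>

lemma norm_vec_square: "(norm (x :: complex ^ 'm))\<^sup>2 = (\<Sum>i\<in>UNIV. (cmod (x $ i))\<^sup>2)"
  by (simp add: norm_vec_def L2_set_def sum_nonneg)

lemma hprod_self: "hprod x x = complex_of_real ((norm x)\<^sup>2)"
  unfolding hprod_def norm_vec_square
  by (simp only: of_real_sum complex_norm_square mult.commute)

lemma hprod_hermitian_mult:
  assumes "hermitian S"
  shows "hprod (S *v x) y = hprod x (S *v y)"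
proof -
  have S: "cnj (S $ i $ j) = S $ j $ i" for i j
    using assms unfolding hermitian_def by (metis complex_cnj_cnj)
  have "hprod (S *v x) y = (\<Sum>i\<in>UNIV. \<Sum>j\<in>UNIV. cnj (x $ j) * (S $ j $ i * y $ i))"
    by (simp add: hprod_def matrix_vector_mult_def S sum_distrib_right sum_distrib_left mult_ac)
  also have "\<dots> = hprod x (S *v y)"
    by (subst sum.swap) (simp add: hprod_def matrix_vector_mult_def sum_distrib_left)
  finally show ?thesis .
qed

text \<open>One Hermitian factor of R = S S is moved across the inner product. This brings in the
  norm A: the variance of ab^H h_d is \<beta>d A^2.\<close>

lemma hprod_psd_sqrt:
  assumes "is_psd_sqrt S R"
  shows "hprod x (R *v x) = complex_of_real ((norm (S *v x))\<^sup>2)"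
proof -
  have "R *v x = S *v (S *v x)"
    using assms by (simp add: is_psd_sqrt_def matrix_vector_mul_assoc)
  then show ?thesis
    using assms hprod_hermitian_mult[of S x "S *v x"] hprod_self[of "S *v x"]
    by (simp add: is_psd_sqrt_def hermitian_psd_def)
qed

lemma lin_comb_eq_hprod: "lin_comb UNIV (($) a) (\<lambda>i \<omega>. h \<omega> $ i) \<omega> = hprod a (h \<omega>)"
  by (simp add: lin_comb_def hprod_def)

lemma herm_form_eq_hprod:
  "herm_form UNIV (($) a) (\<lambda>i j. complex_of_real b * R $ i $ j) = b * Re (hprod a (R *v a))"
proof -
  have "(\<Sum>i\<in>UNIV. \<Sum>j\<in>UNIV. cnj (a $ i) * (complex_of_real b * R $ i $ j) * a $ j)
      = complex_of_real b * hprod a (R *v a)"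
    by (simp add: hprod_def matrix_vector_mult_def sum_distrib_left mult_ac)
  then show ?thesis by (simp add: herm_form_def)
qed

text \<open>The phase p of ab^H h aligns the reflected signal with the direct one: cnj p * ab^H h is
  the modulus of ab^H h, so the cross term is real and nonnegative. The unimodular entries of the
  steering vector produce the factor \<open>CARD('m)\<close>.\<close>

lemma opt_snr_eq:
  fixes a h :: "complex ^ 'm"
  assumes "\<forall>i. cmod (a $ i) = 1" "0 \<le> \<beta>br * \<beta>ru" "hprod a h \<noteq> 0"
  shows "opt_snr \<beta>br \<beta>ru \<tau> a N h g =
    ((\<Sum>i\<in>UNIV. (cmod (h $ i))\<^sup>2)
      + 2 * sqrt (\<beta>br * \<beta>ru) * (cmod (hprod a h) * (\<Sum>n\<in>{1..N}. cmod (g n)))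
      + \<beta>br * \<beta>ru * real CARD('m) * (\<Sum>n\<in>{1..N}. cmod (g n))\<^sup>2) * \<tau>"
proof -
  define r where "r = cmod (hprod a h)"
  define s where "s = sqrt (\<beta>br * \<beta>ru) * (\<Sum>n\<in>{1..N}. cmod (g n))"
  define p where "p = direct_phase a h"
  have r: "r > 0" using assms by (simp add: r_def)
  have p: "hprod a h = complex_of_real r * p"
    using r by (simp add: p_def direct_phase_def r_def)
  have cp: "cmod p = 1"
    \<comment> \<open>The phase has modulus 1 only off the event where ab^H h = 0; on that event
      \<open>direct_phase\<close> is 0.\<close>
    using assms(3) by (simp add: p_def direct_phase_def norm_divide)
  have entry: "(cmod (h $ i + complex_of_real s * p * a $ i))\<^sup>2
      = (cmod (h $ i))\<^sup>2 + 2 * s * Re (cnj p * (cnj (a $ i) * h $ i)) + s\<^sup>2" for i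
  proof -
    have "(cmod (h $ i + complex_of_real s * p * a $ i))\<^sup>2
        = (cmod (h $ i))\<^sup>2 + (cmod (complex_of_real s * p * a $ i))\<^sup>2
          + 2 * Re (h $ i * cnj (complex_of_real s * p * a $ i))"
      by (simp add: cmod_power2) (simp add: power2_eq_square algebra_simps)
    also have "(cmod (complex_of_real s * p * a $ i))\<^sup>2 = s\<^sup>2"
      using assms(1) cp by (simp add: norm_mult power_mult_distrib)
    also have "Re (h $ i * cnj (complex_of_real s * p * a $ i)) = s * Re (cnj p * (cnj (a $ i) * h $ i))"
      by (simp add: algebra_simps)
    finally show ?thesis by simp
  qed
  have "opt_snr \<beta>br \<beta>ru \<tau> a N h g = (\<Sum>i\<in>UNIV. (cmod (h $ i + complex_of_real s * p * a $ i))\<^sup>2) * \<tau>"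
    by (simp add: opt_snr_def hprod_self norm_vec_square opt_channel_def s_def p_def mult_ac)
  also have "(\<Sum>i\<in>UNIV. (cmod (h $ i + complex_of_real s * p * a $ i))\<^sup>2)
      = (\<Sum>i\<in>UNIV. (cmod (h $ i))\<^sup>2) + 2 * s * Re (cnj p * hprod a h) + real CARD('m) * s\<^sup>2"
    unfolding entry
    by (simp add: sum.distrib hprod_def sum_distrib_left sum_subtractf algebra_simps)
  also have "cnj p * hprod a h = complex_of_real r"
    using cp unfolding p by (simp add: complex_norm_square[symmetric] mult_ac)
  also have "s\<^sup>2 = \<beta>br * \<beta>ru * (\<Sum>n\<in>{1..N}. cmod (g n))\<^sup>2"
    using assms(2) by (simp add: s_def power_mult_distrib)
  finally show ?thesis
    by (simp add: s_def r_def mult_ac)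
qed

text \<open>Events determined by f(X) and g(Y) lie in the sigma-algebras generated by X and Y. The
  variables X and Y may have different types; f and g map them into a common one, where
  \<open>indep_var\<close> can be stated.\<close>

lemma (in prob_space) indep_var_of_indep_vimage_algebra:
  assumes indep: "indep_set (sets (vimage_algebra (space M) X S)) (sets (vimage_algebra (space M) Y T))"
    and XY: "X \<in> space M \<rightarrow> space S" "Y \<in> space M \<rightarrow> space T"
    and f: "f \<in> measurable S S'" and g: "g \<in> measurable T T'"
  shows "indep_var S' (\<lambda>\<omega>. f (X \<omega>)) T' (\<lambda>\<omega>. g (Y \<omega>))"
proof -
  let ?A = "vimage_algebra (space M) X S" and ?B = "vimage_algebra (space M) Y T"
  have sub: "sets ?A \<subseteq> events" "sets ?B \<subseteq> events"
    and prod: "\<And>a b. a \<in> sets ?A \<Longrightarrow> b \<in> sets ?B \<Longrightarrow> prob (a \<inter> b) = prob a * prob b"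
    using indep by (auto simp: indep_sets2_eq)
  have meas: "(\<lambda>\<omega>. f (X \<omega>)) \<in> measurable ?A S'" "(\<lambda>\<omega>. g (Y \<omega>)) \<in> measurable ?B T'"
    using measurable_compose[OF measurable_vimage_algebra1[OF XY(1)] f]
      measurable_compose[OF measurable_vimage_algebra1[OF XY(2)] g] by auto
  have rv: "(\<lambda>\<omega>. f (X \<omega>)) \<in> measurable M S'" "(\<lambda>\<omega>. g (Y \<omega>)) \<in> measurable M T'"
    using measurable_mono[of S' S' ?A M] measurable_mono[of T' T' ?B M] meas sub by simp_all blast+
  have gen: "sigma_sets (space M) {h -` A \<inter> space M |A. A \<in> sets U} \<subseteq> sets V"
    if "h \<in> measurable V U" "space V = space M" for h U and V :: "'a measure"
  proof -
    have "{h -` A \<inter> space V |A. A \<in> sets U} \<subseteq> sets V"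
      using that(1) by (auto intro: measurable_sets)
    from sets.sigma_sets_subset[OF this] show ?thesis
      by (simp add: that(2))
  qed
  have genA: "sigma_sets (space M) {(\<lambda>\<omega>. f (X \<omega>)) -` A \<inter> space M |A. A \<in> sets S'} \<subseteq> sets ?A"
    and genB: "sigma_sets (space M) {(\<lambda>\<omega>. g (Y \<omega>)) -` A \<inter> space M |A. A \<in> sets T'} \<subseteq> sets ?B"
    using gen[OF meas(1)] gen[OF meas(2)] by simp_all
  show ?thesis
    unfolding indep_var_eq indep_sets2_eq
    by (intro conjI rv ballI subset_trans[OF genA sub(1)] subset_trans[OF genB sub(2)] prod
        subsetD[OF genA] subsetD[OF genB])
qed

lemma (in prob_space) has_bochner_integral_indep_mult:
  fixes X Y :: "'a \<Rightarrow> real"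
  assumes "indep_var borel X borel Y" "has_bochner_integral M X x" "has_bochner_integral M Y y"
  shows "has_bochner_integral M (\<lambda>\<omega>. X \<omega> * Y \<omega>) (x * y)"
  using indep_var_lebesgue_integral[OF assms(1)] indep_var_integrable[OF assms(1)] assms(2,3)
  by (auto simp: has_bochner_integral_iff)

text \<open>The correlation of the UE-RIS channel affects the mean only through the unit diagonal
  and the common cross moment \<kappa>, so one formula serves both extreme cases.\<close>

lemma mean_snr_eq:
  fixes Rd Rd_half :: "complex ^ 'm ^ 'm" and ab :: "complex ^ 'm"
    and P :: "'w measure" and h_d :: "'w \<Rightarrow> complex ^ 'm" and h_ru :: "'w \<Rightarrow> nat \<Rightarrow> complex"
  assumes pos: "\<beta>d > 0" "\<beta>br > 0" "\<beta>ru > 0"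
    and Rd: "\<forall>i. Rd $ i $ i = 1" "is_psd_sqrt Rd_half Rd"
    and ab: "\<forall>i. cmod (ab $ i) = 1" "Rd_half *v ab \<noteq> 0"
    and model: "fading_model \<beta>d Rd N Rru P h_d h_ru"
    and diag: "\<And>n. n \<in> {1..N} \<Longrightarrow> Rru n n = 1"
    and cross: "\<And>m n. m \<in> {1..N} \<Longrightarrow> n \<in> {1..N} \<Longrightarrow> m \<noteq> n \<Longrightarrow>
      has_bochner_integral P (\<lambda>\<omega>. cmod (h_ru \<omega> m) * cmod (h_ru \<omega> n)) \<kappa>"
  shows "mean_snr \<beta>br \<beta>ru \<tau> ab N P h_d h_ru =
    (\<beta>d * real CARD('m) + real N * norm (Rd_half *v ab) * pi / 2 * sqrt (\<beta>d * \<beta>br * \<beta>ru)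
      + \<beta>br * \<beta>ru * real CARD('m) * (real N + real N * (real N - 1) * \<kappa>)) * \<tau>"
proof -
  interpret prob_space P using model by (simp add: fading_model_def)
  let ?A = "norm (Rd_half *v ab)"
  let ?Sum = "\<lambda>g. \<Sum>n\<in>{1..N}. cmod (g n)"
  have h_d: "complex_normal_vector P UNIV (\<lambda>i \<omega>. h_d \<omega> $ i) (\<lambda>i j. complex_of_real \<beta>d * Rd $ i $ j)"
    and h_ru: "complex_normal_vector P {1..N} (\<lambda>n \<omega>. h_ru \<omega> n) Rru"
    using model by (simp_all add: fading_model_def)
  have form: "herm_form UNIV (($) ab) (\<lambda>i j. complex_of_real \<beta>d * Rd $ i $ j) = \<beta>d * ?A\<^sup>2"
    by (simp add: herm_form_eq_hprod hprod_psd_sqrt[OF Rd(2)])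
  have "?A > 0" using ab(2) by simp
  have hd_sq: "has_bochner_integral P (\<lambda>\<omega>. (cmod (h_d \<omega> $ i))\<^sup>2) \<beta>d" for i
    using has_bochner_integral_cmod_lin_comb_square[OF h_d, of "\<lambda>j. if j = i then 1 else 0"] pos Rd(1)
    by (simp add: lin_comb_single herm_form_single)
  have hd_power: "has_bochner_integral P (\<lambda>\<omega>. \<Sum>i\<in>UNIV. (cmod (h_d \<omega> $ i))\<^sup>2) (\<beta>d * real CARD('m))"
    using has_bochner_integral_sum[of UNIV P "\<lambda>i \<omega>. (cmod (h_d \<omega> $ i))\<^sup>2" "\<lambda>_. \<beta>d"] hd_sq
    by (simp add: mult.commute)
  have proj: "has_bochner_integral P (\<lambda>\<omega>. cmod (hprod ab (h_d \<omega>))) (sqrt pi / 2 * (sqrt \<beta>d * ?A))"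
    using has_bochner_integral_cmod_lin_comb[OF h_d, of "($) ab"] pos
    by (simp add: lin_comb_eq_hprod form real_sqrt_mult)
  \<comment> \<open>Since A > 0, the projection has positive variance and vanishes only on a null
    set.\<close>
  have nonzero: "AE \<omega> in P. hprod ab (h_d \<omega>) \<noteq> 0"
    using AE_lin_comb_nonzero[OF h_d, of "($) ab"] pos \<open>?A > 0\<close>
    by (simp add: lin_comb_eq_hprod form)
  have ru: "has_bochner_integral P (\<lambda>\<omega>. cmod (h_ru \<omega> n)) (sqrt pi / 2)"
    and ru_sq: "has_bochner_integral P (\<lambda>\<omega>. (cmod (h_ru \<omega> n))\<^sup>2) 1" if "n \<in> {1..N}" for n
    using has_bochner_integral_cmod_lin_comb[OF h_ru, of "\<lambda>j. if j = n then 1 else 0"]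
      has_bochner_integral_cmod_lin_comb_square[OF h_ru, of "\<lambda>j. if j = n then 1 else 0"] that
    by (simp_all add: lin_comb_single herm_form_single diag)
  have ru_sum: "has_bochner_integral P (\<lambda>\<omega>. ?Sum (h_ru \<omega>)) (real N * (sqrt pi / 2))"
    using has_bochner_integral_sum[of "{1..N}" P "\<lambda>n \<omega>. cmod (h_ru \<omega> n)" "\<lambda>_. sqrt pi / 2"] ru
    by simp
  \<comment> \<open>The squared sum has N diagonal terms of mean 1 and N (N - 1) off-diagonal terms
    of mean \<kappa>.\<close>
  have "has_bochner_integral P (\<lambda>\<omega>. \<Sum>m\<in>{1..N}. \<Sum>n\<in>{1..N}. cmod (h_ru \<omega> m) * cmod (h_ru \<omega> n))
      (\<Sum>m\<in>{1..N}. \<Sum>n\<in>{1..N}. if n = m then 1 else \<kappa>)"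
    using ru_sq cross by (intro has_bochner_integral_sum) (auto simp: power2_eq_square)
  also have "(\<lambda>\<omega>. \<Sum>m\<in>{1..N}. \<Sum>n\<in>{1..N}. cmod (h_ru \<omega> m) * cmod (h_ru \<omega> n)) = (\<lambda>\<omega>. (?Sum (h_ru \<omega>))\<^sup>2)"
    by (simp add: power2_eq_square sum_product)
  also have "(\<Sum>m\<in>{1..N}. \<Sum>n\<in>{1..N}. if n = m then 1 else \<kappa>) = (\<Sum>m\<in>{1..N}. 1 + (real N - 1) * \<kappa>)"
  proof (rule sum.cong)
    fix m assume m: "m \<in> {1..N}"
    then have "(\<Sum>n\<in>{1..N}. if n = m then 1 else \<kappa>) = 1 + (\<Sum>n\<in>{1..N} - {m}. if n = m then 1 else \<kappa>)"
      by (subst sum.remove[of _ m]) auto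
    also have "(\<Sum>n\<in>{1..N} - {m}. if n = m then 1 else \<kappa>) = (\<Sum>n\<in>{1..N} - {m}. \<kappa>)"
      by (rule sum.cong) auto
    finally show "(\<Sum>n\<in>{1..N}. if n = m then 1 else \<kappa>) = 1 + (real N - 1) * \<kappa>"
      using m by (simp add: of_nat_diff)
  qed simp
  also have "\<dots> = real N + real N * (real N - 1) * \<kappa>"
    by (simp add: algebra_simps)
  finally have ru_sum_sq: "has_bochner_integral P (\<lambda>\<omega>. (?Sum (h_ru \<omega>))\<^sup>2) (real N + real N * (real N - 1) * \<kappa>)" .
  \<comment> \<open>The model states independence for the restriction of \<open>h_ru\<close> to
    {1..N}; the sum over {1..N} does not see the restriction.\<close>
  have "indep_var borel (\<lambda>\<omega>. cmod (hprod ab (h_d \<omega>))) borel (\<lambda>\<omega>. ?Sum (restrict (h_ru \<omega>) {1..N}))"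
  proof (rule indep_var_of_indep_vimage_algebra[where f = "\<lambda>h. cmod (hprod ab h)" and X = h_d
        and g = ?Sum and Y = "\<lambda>\<omega>. restrict (h_ru \<omega>) {1..N}"])
    show "indep_set (sets (vimage_algebra (space P) h_d borel))
       (sets (vimage_algebra (space P) (\<lambda>\<omega>. restrict (h_ru \<omega>) {1..N}) (PiM {1..N} (\<lambda>_. borel))))"
      using model by (simp add: fading_model_def)
    show "(\<lambda>h. cmod (hprod ab h)) \<in> borel_measurable borel"
      unfolding hprod_def by (intro borel_measurable_continuous_onI continuous_intros)
  qed (auto simp: space_PiM)
  then have indep: "indep_var borel (\<lambda>\<omega>. cmod (hprod ab (h_d \<omega>))) borel (\<lambda>\<omega>. ?Sum (h_ru \<omega>))"
    by simp
  \<comment> \<open>Expectation term by term; independence is used only for the middle term.\<close>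
  have "has_bochner_integral P (\<lambda>\<omega>. ((\<Sum>i\<in>UNIV. (cmod (h_d \<omega> $ i))\<^sup>2)
        + 2 * sqrt (\<beta>br * \<beta>ru) * (cmod (hprod ab (h_d \<omega>)) * ?Sum (h_ru \<omega>))
        + \<beta>br * \<beta>ru * real CARD('m) * (?Sum (h_ru \<omega>))\<^sup>2) * \<tau>)
      ((\<beta>d * real CARD('m) + 2 * sqrt (\<beta>br * \<beta>ru) * ((sqrt pi / 2 * (sqrt \<beta>d * ?A)) * (real N * (sqrt pi / 2)))
        + \<beta>br * \<beta>ru * real CARD('m) * (real N + real N * (real N - 1) * \<kappa>)) * \<tau>)"
    by (intro has_bochner_integral_mult_left has_bochner_integral_add has_bochner_integral_mult_right
        hd_power ru_sum_sq has_bochner_integral_indep_mult[OF indep proj ru_sum])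
  then have "(\<integral>\<omega>. ((\<Sum>i\<in>UNIV. (cmod (h_d \<omega> $ i))\<^sup>2)
        + 2 * sqrt (\<beta>br * \<beta>ru) * (cmod (hprod ab (h_d \<omega>)) * ?Sum (h_ru \<omega>))
        + \<beta>br * \<beta>ru * real CARD('m) * (?Sum (h_ru \<omega>))\<^sup>2) * \<tau> \<partial>P)
      = (\<beta>d * real CARD('m) + 2 * sqrt (\<beta>br * \<beta>ru) * ((sqrt pi / 2 * (sqrt \<beta>d * ?A)) * (real N * (sqrt pi / 2)))
        + \<beta>br * \<beta>ru * real CARD('m) * (real N + real N * (real N - 1) * \<kappa>)) * \<tau>"
    by (rule has_bochner_integral_integral_eq)
  moreover have "(\<integral>\<omega>. opt_snr \<beta>br \<beta>ru \<tau> ab N (h_d \<omega>) (h_ru \<omega>) \<partial>P)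
      = (\<integral>\<omega>. ((\<Sum>i\<in>UNIV. (cmod (h_d \<omega> $ i))\<^sup>2)
        + 2 * sqrt (\<beta>br * \<beta>ru) * (cmod (hprod ab (h_d \<omega>)) * ?Sum (h_ru \<omega>))
        + \<beta>br * \<beta>ru * real CARD('m) * (?Sum (h_ru \<omega>))\<^sup>2) * \<tau> \<partial>P)"
  proof (rule integral_cong_AE)
    have [measurable]: "(\<lambda>\<omega>. h_d \<omega> $ i) \<in> borel_measurable P" for i
      using complex_normal_vector_measurable[OF h_d] by simp
    have [measurable]: "(\<lambda>\<omega>. h_ru \<omega> n) \<in> borel_measurable P" if "n \<in> {1..N}" for n
      using complex_normal_vector_measurable[OF h_ru that] by simp
    have [measurable]: "(\<lambda>\<omega>. ?Sum (h_ru \<omega>)) \<in> borel_measurable P"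
      by (intro borel_measurable_sum) simp
    show "(\<lambda>\<omega>. opt_snr \<beta>br \<beta>ru \<tau> ab N (h_d \<omega>) (h_ru \<omega>)) \<in> borel_measurable P"
      unfolding opt_snr_def opt_channel_def direct_phase_def hprod_def
        vector_add_component vector_smult_component
      by measurable
    show "(\<lambda>\<omega>. ((\<Sum>i\<in>UNIV. (cmod (h_d \<omega> $ i))\<^sup>2)
        + 2 * sqrt (\<beta>br * \<beta>ru) * (cmod (hprod ab (h_d \<omega>)) * ?Sum (h_ru \<omega>))
        + \<beta>br * \<beta>ru * real CARD('m) * (?Sum (h_ru \<omega>))\<^sup>2) * \<tau>) \<in> borel_measurable P"
      unfolding hprod_def by measurable
    show "AE \<omega> in P. opt_snr \<beta>br \<beta>ru \<tau> ab N (h_d \<omega>) (h_ru \<omega>) =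
        ((\<Sum>i\<in>UNIV. (cmod (h_d \<omega> $ i))\<^sup>2)
        + 2 * sqrt (\<beta>br * \<beta>ru) * (cmod (hprod ab (h_d \<omega>)) * ?Sum (h_ru \<omega>))
        + \<beta>br * \<beta>ru * real CARD('m) * (?Sum (h_ru \<omega>))\<^sup>2) * \<tau>"
      using nonzero by eventually_elim (use pos ab(1) in \<open>simp add: opt_snr_eq\<close>)
  qed
  \<comment> \<open>The two mean moduli contribute (sqrt pi / 2)^2 = pi / 4, which the leading 2
    turns into pi / 2.\<close>
  moreover have "2 * sqrt (\<beta>br * \<beta>ru) * ((sqrt pi / 2 * (sqrt \<beta>d * ?A)) * (real N * (sqrt pi / 2)))
      = real N * ?A * pi / 2 * sqrt (\<beta>d * \<beta>br * \<beta>ru)"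
    using real_sqrt_mult_self[of pi] by (simp add: real_sqrt_mult field_simps)
  ultimately show ?thesis
    by (simp only: mean_snr_def)
qed

section \<open>Closed form, limit and numerical value of the gain\<close>

lemma gain_limit_bound: "\<bar>(4 - pi) / pi * 100 - 27.32\<bar> < 0.005"
proof -
  have "(4 - pi) / pi * 100 - 27.32 = (400 - 127.32 * pi) / pi"
    by (simp add: field_simps)
  \<comment> \<open>Multiplied by pi, the claim is linear in pi and follows from
    \<open>pi_approx\<close>. The tolerance is half a unit of the second decimal, so 27.32 is
    correctly rounded.\<close>
  moreover have "\<bar>400 - 127.32 * pi\<bar> < 0.005 * pi"
    using pi_approx by (simp add: abs_less_iff)
  ultimately show ?thesis
    by (simp add: abs_divide pos_divide_less_eq)
qed

lemma gain_corr_closed_form: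
  fixes \<beta>d b \<tau> A M N :: real
  assumes "\<beta>d > 0" "b > 0" "\<tau> > 0" "A \<ge> 0" "M > 0" "N \<ge> 1"
  shows "gain_corr
      ((\<beta>d * M + N * A * pi / 2 * sqrt (\<beta>d * b) + b * M * (N + N * (N - 1) * 1)) * \<tau>)
      ((\<beta>d * M + N * A * pi / 2 * sqrt (\<beta>d * b) + b * M * (N + N * (N - 1) * (pi / 4))) * \<tau>)
    = ((4 - pi) * N\<^sup>2 + (pi - 4) * N) /
      (pi * N\<^sup>2 + (4 - pi) * N + 4 * \<beta>d / b + 2 * N * A * pi * sqrt \<beta>d / (M * sqrt b))"
proof -
  \<comment> \<open>D is the uncorrelated mean SNR multiplied by 4 / (b M \<tau>), a factor that
    cancels in the gain.\<close>
  define D where "D = pi * N\<^sup>2 + (4 - pi) * N + 4 * \<beta>d / b + 2 * N * A * pi * sqrt \<beta>d / (M * sqrt b)"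
  \<comment> \<open>Extracting a factor b from the cross term leaves sqrt b in its denominator, as
    in D.\<close>
  have "sqrt (\<beta>d * b) = b * (sqrt \<beta>d / sqrt b)"
    using assms by (simp add: real_sqrt_mult field_simps)
  then have LB: "(\<beta>d * M + N * A * pi / 2 * sqrt (\<beta>d * b) + b * M * (N + N * (N - 1) * (pi / 4))) * \<tau>
      = (b * M * \<tau> / 4) * D"
    using assms by (simp add: D_def field_simps power2_eq_square)
  have "gain_corr
      ((\<beta>d * M + N * A * pi / 2 * sqrt (\<beta>d * b) + b * M * (N + N * (N - 1) * 1)) * \<tau>)
      ((\<beta>d * M + N * A * pi / 2 * sqrt (\<beta>d * b) + b * M * (N + N * (N - 1) * (pi / 4))) * \<tau>)
    = (b * M * \<tau> / 4) * ((4 - pi) * N\<^sup>2 + (pi - 4) * N) / ((b * M * \<tau> / 4) * D)"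
    unfolding gain_corr_def LB[symmetric]
    by (rule arg_cong2[where f = "(/)"]) (simp_all add: field_simps power2_eq_square)
  also have "\<dots> = ((4 - pi) * N\<^sup>2 + (pi - 4) * N) / D"
    using assms by simp
  finally show ?thesis
    by (simp add: D_def)
qed

lemma tendsto_quadratic_quotient:
  fixes a b c d e :: real
  assumes "c \<noteq> 0"
  shows "(\<lambda>n. (a * (real n)\<^sup>2 + b * real n) / (c * (real n)\<^sup>2 + d * real n + e)) \<longlonglongrightarrow> a / c"
proof -
  \<comment> \<open>Numerator and denominator are divided by n^2, which is legitimate for n > 0 and
    hence eventually.\<close>
  have "(\<lambda>n. (a + b * (1 / real n)) / (c + d * (1 / real n) + e * (1 / real n)\<^sup>2)) \<longlonglongrightarrow> (a + b * 0) / (c + d * 0 + e * 0\<^sup>2)"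
    using assms by (intro tendsto_intros lim_1_over_n) auto
  moreover have "\<forall>\<^sub>F n in sequentially. (a + b * (1 / real n)) / (c + d * (1 / real n) + e * (1 / real n)\<^sup>2)
      = (a * (real n)\<^sup>2 + b * real n) / (c * (real n)\<^sup>2 + d * real n + e)"
  proof (rule eventually_mono[OF eventually_gt_at_top[of 0]])
    fix n :: nat assume n: "n > 0"
    have "a * (real n)\<^sup>2 + b * real n = (real n)\<^sup>2 * (a + b * (1 / real n))"
      "c * (real n)\<^sup>2 + d * real n + e = (real n)\<^sup>2 * (c + d * (1 / real n) + e * (1 / real n)\<^sup>2)"
      using n by (simp_all add: field_simps power2_eq_square)
    then have "(a * (real n)\<^sup>2 + b * real n) / (c * (real n)\<^sup>2 + d * real n + e)
        = ((real n)\<^sup>2 * (a + b * (1 / real n))) / ((real n)\<^sup>2 * (c + d * (1 / real n) + e * (1 / real n)\<^sup>2))"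
      by (simp only:)
    then show "(a + b * (1 / real n)) / (c + d * (1 / real n) + e * (1 / real n)\<^sup>2)
      = (a * (real n)\<^sup>2 + b * real n) / (c * (real n)\<^sup>2 + d * real n + e)"
      using n by simp
  qed
  ultimately show ?thesis
    by (simp add: tendsto_cong)
qed

text \<open>Both mean SNRs are derived from the fading models. The probability spaces may vary with
  N and between the two cases, since each mean depends only on the law of its own model.\<close>

theorem mainTheorem5:
  fixes Rd Rd_half :: "complex ^ 'm ^ 'm" and ab :: "complex ^ 'm"
    and \<beta>d \<beta>br \<beta>ru \<tau> A :: real
    and P_LB :: "nat \<Rightarrow> 'l measure" and hd_LB :: "nat \<Rightarrow> 'l \<Rightarrow> complex ^ 'm"
    and hru_LB :: "nat \<Rightarrow> 'l \<Rightarrow> nat \<Rightarrow> complex"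
    and P_UB :: "nat \<Rightarrow> 'u measure" and hd_UB :: "nat \<Rightarrow> 'u \<Rightarrow> complex ^ 'm"
    and hru_UB :: "nat \<Rightarrow> 'u \<Rightarrow> nat \<Rightarrow> complex"
    and E_LB E_UB :: "nat \<Rightarrow> real"
  assumes "\<beta>d > 0" and "\<beta>br > 0" and "\<beta>ru > 0" and "\<tau> > 0"
    and "hermitian_psd Rd" and "\<forall>i. Rd $ i $ i = 1"
    and "is_psd_sqrt Rd_half Rd"
    and "\<forall>i. cmod (ab $ i) = 1"
    and "Rd_half *v ab \<noteq> 0"
    and "A = norm (Rd_half *v ab)"
    and "\<forall>N\<ge>1. fading_model \<beta>d Rd N uncorrelated (P_LB N) (hd_LB N) (hru_LB N)"
    and "\<forall>N\<ge>1. fading_model \<beta>d Rd N fully_correlated (P_UB N) (hd_UB N) (hru_UB N)"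
    and "\<forall>N\<ge>1. E_LB N = mean_snr \<beta>br \<beta>ru \<tau> ab N (P_LB N) (hd_LB N) (hru_LB N)"
    and "\<forall>N\<ge>1. E_UB N = mean_snr \<beta>br \<beta>ru \<tau> ab N (P_UB N) (hd_UB N) (hru_UB N)"
  shows "(\<forall>N\<ge>1. gain_corr (E_UB N) (E_LB N) =
            ((4 - pi) * (real N)\<^sup>2 + (pi - 4) * real N) /
            (pi * (real N)\<^sup>2 + (4 - pi) * real N + 4 * \<beta>d / (\<beta>br * \<beta>ru)
              + 2 * real N * A * pi * sqrt \<beta>d / (real CARD('m) * sqrt (\<beta>br * \<beta>ru)))) \<and>
         (\<lambda>N. gain_corr (E_UB N) (E_LB N)) \<longlonglongrightarrow> (4 - pi) / pi \<and>
         \<bar>(4 - pi) / pi * 100 - 27.32\<bar> < 0.005"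
proof (intro conjI allI impI)
  note pos = assms(1-4) and Rd = assms(6,7) and ab = assms(8,9)
  let ?A = "norm (Rd_half *v ab)" and ?M = "real CARD('m)"
  let ?b = "\<beta>br * \<beta>ru"
  \<comment> \<open>The mean SNR as a function of the cross moment: \<kappa> = pi / 4 is the
    uncorrelated case, \<kappa> = 1 the fully correlated one.\<close>
  let ?mean = "\<lambda>N \<kappa>. (\<beta>d * ?M + real N * ?A * pi / 2 * sqrt (\<beta>d * ?b)
    + ?b * ?M * (real N + real N * (real N - 1) * \<kappa>)) * \<tau>"
  have LB: "E_LB N = ?mean N (pi / 4)" if "N \<ge> 1" for N
  proof -
    have model: "fading_model \<beta>d Rd N uncorrelated (P_LB N) (hd_LB N) (hru_LB N)"
      using assms(11) that by blast
    then have "prob_space (P_LB N)" "complex_normal_vector (P_LB N) {1..N} (\<lambda>n \<omega>. hru_LB N \<omega> n) uncorrelated"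
      by (simp_all add: fading_model_def)
    note cross = uncorrelated_cross_moment[OF this finite_atLeastAtMost]
    show ?thesis
      using mean_snr_eq[OF pos(1-3) Rd ab model _ cross] assms(13) that
      by (simp add: uncorrelated_def mult.assoc)
  qed
  have UB: "E_UB N = ?mean N 1" if "N \<ge> 1" for N
  proof -
    have model: "fading_model \<beta>d Rd N fully_correlated (P_UB N) (hd_UB N) (hru_UB N)"
      using assms(12) that by blast
    then have "complex_normal_vector (P_UB N) {1..N} (\<lambda>n \<omega>. hru_UB N \<omega> n) fully_correlated"
      by (simp add: fading_model_def)
    note cross = fully_correlated_cross_moment[OF this finite_atLeastAtMost]
    show ?thesis
      using mean_snr_eq[OF pos(1-3) Rd ab model _ cross] assms(14) that
      by (simp add: fully_correlated_def mult.assoc)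
  qed
  show closed: "gain_corr (E_UB N) (E_LB N) =
      ((4 - pi) * (real N)\<^sup>2 + (pi - 4) * real N) /
      (pi * (real N)\<^sup>2 + (4 - pi) * real N + 4 * \<beta>d / (\<beta>br * \<beta>ru)
        + 2 * real N * A * pi * sqrt \<beta>d / (real CARD('m) * sqrt (\<beta>br * \<beta>ru)))"
    if "N \<ge> 1" for N
    unfolding LB[OF that] UB[OF that] assms(10)
    using pos that by (intro gain_corr_closed_form) auto
  \<comment> \<open>The term with A is linear in N, so it joins the linear coefficient of the
    denominator and does not affect the limit.\<close>
  let ?d = "4 - pi + 2 * A * pi * sqrt \<beta>d / (?M * sqrt ?b)"
  have "\<forall>\<^sub>F N in sequentially. gain_corr (E_UB N) (E_LB N) =
      ((4 - pi) * (real N)\<^sup>2 + (pi - 4) * real N) / (pi * (real N)\<^sup>2 + ?d * real N + 4 * \<beta>d / ?b)"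
    using eventually_ge_at_top[of 1]
  proof eventually_elim
    case (elim N)
    then show ?case
      unfolding closed[OF elim] by (simp add: algebra_simps)
  qed
  then show "(\<lambda>N. gain_corr (E_UB N) (E_LB N)) \<longlonglongrightarrow> (4 - pi) / pi"
    by (subst tendsto_cong) (auto intro: tendsto_quadratic_quotient)
  show "\<bar>(4 - pi) / pi * 100 - 27.32\<bar> < 0.005"
    by (rule gain_limit_bound)
qed

end
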